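(* Let $\mu$ be a rotation-invariant positive Borel measure on $\mathbb{C}^n$ ($n\ge1$) such that $m_d=\int_{\mathbb{C}^n}|z|^{2d}\,d\mu$ satisfies $0<m_d<\infty$ for all $d\in\mathbb{N}$. Then the canonical solution operator to $\bar\partial$ is bounded on $A^2_{(0,1)}(d\mu)$ if and only if $$\sup_{d\ge1}\left(\frac{(2n+d-1)\,m_{d+1}}{(n+d)\,m_d}-\frac{m_d}{m_{d-1}}\right)<\infty .$$
   Context: $\mathbb{N}=\{0,1,2,\dots\}$; $|z|^2=\sum_j|z_j|^2$. Rotation-invariant means invariant under the unitary group $U(n)$; in particular the monomials are pairwise orthogonal in $L^2(d\mu)$. $A^2(d\mu)$ is the closure in $L^2(d\mu)$ of the linear span of the monomials $z^\alpha$, $\alpha\in\mathbb{N}^n$. $A^2_{(0,1)}(d\mu)$ is the Hilbert space of $(0,1)$-forms $\sum_{j=1}^n f_j\,d\bar z_j$ with $f_j\in A^2(d\mu)$, with norm squared $\sum_j\|f_j\|^2_{L^2(d\mu)}$. Canonical solution operator $S$: $S\omega$ is the solution $f\in L^2(d\mu)$ of $\bar\partial f=\omega$ that is orthogonal to $A^2(d\mu)$. Concretely, since $\bar\partial(\bar z_j z^\alpha)=z^\alpha d\bar z_j$, on the dense subspace of forms with polynomial coefficients (finite linear combinations of the $z^\alpha d\bar z_j$) $S$ is the linear map for which $S(z^\alpha d\bar z_j)$ is the unique element of $\bar z_j z^\alpha+A^2(d\mu)$ orthogonal to $A^2(d\mu)$. "Bounded" means that this densely defined map extends to a bounded operator $A^2_{(0,1)}(d\mu)\to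 L^2(d\mu)$. *)

theory Defs
  imports "HOL-Analysis.Analysis"
begin

definition unitary_matrix :: "complex ^ 'n ^ 'n \<Rightarrow> bool" where
  "unitary_matrix U \<longleftrightarrow>
     map_matrix cnj (transpose U) ** U = mat 1 \<and> U ** map_matrix cnj (transpose U) = mat 1"

definition rotation_invariant :: "(complex ^ 'n) measure \<Rightarrow> bool" where
  "rotation_invariant M \<longleftrightarrow> (\<forall>U. unitary_matrix U \<longrightarrow> distr M M (\<lambda>z. U *v z) = M)"

definition moment :: "(complex ^ 'n) measure \<Rightarrow> nat \<Rightarrow> ennreal" where
  "moment M d = (\<integral>\<^sup>+ z. ennreal (norm z ^ (2 * d)) \<partial>M)"

text \<open>
  Elements of the space of square integrable functions are represented by functions, not by
  classes modulo null sets; equality of elements is therefore equality almost everywhere.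
\<close>

definition L2 :: "'a measure \<Rightarrow> ('a \<Rightarrow> complex) set" where
  "L2 M = {f \<in> borel_measurable M. integrable M (\<lambda>z. (cmod (f z))\<^sup>2)}"

definition L2_norm :: "'a measure \<Rightarrow> ('a \<Rightarrow> complex) \<Rightarrow> real" where
  "L2_norm M f = sqrt (\<integral>z. (cmod (f z))\<^sup>2 \<partial>M)"

definition L2_inner :: "'a measure \<Rightarrow> ('a \<Rightarrow> complex) \<Rightarrow> ('a \<Rightarrow> complex) \<Rightarrow> complex" where
  "L2_inner M f g = (\<integral>z. f z * cnj (g z) \<partial>M)"

definition monomial :: "('n \<Rightarrow> nat) \<Rightarrow> complex ^ 'n \<Rightarrow> complex" where
  "monomial \<alpha> z = (\<Prod>i\<in>UNIV. (z $ i) ^ \<alpha> i)"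

definition polynomials :: "(complex ^ 'n \<Rightarrow> complex) set" where
  "polynomials = {\<lambda>z. \<Sum>\<alpha>\<in>A. c \<alpha> * monomial \<alpha> z | A c. finite A}"

definition A2 :: "(complex ^ 'n) measure \<Rightarrow> (complex ^ 'n \<Rightarrow> complex) set" where
  "A2 M = {f \<in> L2 M. \<forall>\<epsilon>>0. \<exists>p \<in> polynomials \<inter> L2 M. L2_norm M (\<lambda>z. f z - p z) < \<epsilon>}"

text \<open>A (0,1)-form is represented by the family of its coefficients.\<close>

type_synonym 'n form01 = "'n \<Rightarrow> complex ^ 'n \<Rightarrow> complex"

definition A2_01 :: "(complex ^ 'n) measure \<Rightarrow> 'n form01 set" where
  "A2_01 M = {\<omega>. \<forall>j. \<omega> j \<in> A2 M}"

definition form_norm :: "(complex ^ 'n) measure \<Rightarrow> 'n form01 \<Rightarrow> real" where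
  "form_norm M \<omega> = sqrt (\<Sum>j\<in>UNIV. (L2_norm M (\<omega> j))\<^sup>2)"

definition polynomial_forms :: "'n::finite form01 set" where
  "polynomial_forms = {\<omega>. \<forall>j. \<omega> j \<in> polynomials}"

definition monomial_form :: "('n::finite \<Rightarrow> nat) \<Rightarrow> 'n \<Rightarrow> 'n form01" where
  "monomial_form \<alpha> j = (\<lambda>k z. if k = j then monomial \<alpha> z else 0)"

definition linear_on_forms ::
  "(complex ^ 'n) measure \<Rightarrow> 'n form01 set \<Rightarrow> ('n form01 \<Rightarrow> complex ^ 'n \<Rightarrow> complex) \<Rightarrow> bool" where
  "linear_on_forms M D T \<longleftrightarrow>
     (\<forall>\<omega>\<in>D. \<forall>\<eta>\<in>D. \<forall>a b.
        AE z in M. T (\<lambda>j z. a * \<omega> j z + b * \<eta> j z) z = a * T \<omega> z + b * T \<eta> z)"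

definition is_canonical_solution_operator ::
  "(complex ^ 'n) measure \<Rightarrow> ('n form01 \<Rightarrow> complex ^ 'n \<Rightarrow> complex) \<Rightarrow> bool" where
  "is_canonical_solution_operator M S \<longleftrightarrow>
     (\<forall>\<omega>\<in>polynomial_forms. S \<omega> \<in> L2 M) \<and>
     linear_on_forms M polynomial_forms S \<and>
     (\<forall>\<alpha> j. (\<lambda>z. S (monomial_form \<alpha> j) z - cnj (z $ j) * monomial \<alpha> z) \<in> A2 M \<and>
             (\<forall>g\<in>A2 M. L2_inner M (S (monomial_form \<alpha> j)) g = 0))"

text \<open>
  Such an operator is determined only up to null sets, hence the choice operator. Only its
  values on \<^const>\<open>polynomial_forms\<close> are meaningful.
\<close>

definition canonical_solution_operator ::
  "(complex ^ 'n) measure \<Rightarrow> 'n form01 \<Rightarrow> complex ^ 'n \<Rightarrow> complex" where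
  "canonical_solution_operator M = (SOME S. is_canonical_solution_operator M S)"

text \<open>
  Linearity and the norm bound force \<open>T\<close> to respect equality almost everywhere of forms.
\<close>

definition bounded_on_A2_01 ::
  "(complex ^ 'n) measure \<Rightarrow> ('n form01 \<Rightarrow> complex ^ 'n \<Rightarrow> complex) \<Rightarrow> bool" where
  "bounded_on_A2_01 M S \<longleftrightarrow>
     (\<exists>T. (\<forall>\<omega>\<in>A2_01 M. T \<omega> \<in> L2 M) \<and>
          linear_on_forms M (A2_01 M) T \<and>
          (\<exists>C. \<forall>\<omega>\<in>A2_01 M. L2_norm M (T \<omega>) \<le> C * form_norm M \<omega>) \<and>
          (\<forall>\<omega>\<in>polynomial_forms. AE z in M. T \<omega> z = S \<omega> z))"

end

theory Submission
  imports Defs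
begin

text \<open>
  Write \<open>n\<close> for the dimension, \<open>e\<^sub>j\<close> for the \<open>j\<close>-th unit multi-index, \<open>z\<^sup>*\<close> for the complex
  conjugate and \<open>S\<close> for the canonical solution operator. Two parts of the unitary group are used.

  Diagonal unitary matrices split the problem into finite blocks. The canonical solution of
  \<open>z\<^sup>\<alpha> dz\<^sup>*\<^sub>j\<close> has weight \<open>\<alpha> - e\<^sub>j\<close> under the torus, so canonical solutions with
  different weights are orthogonal (lemma \<open>gram_sol_eq_0\<close>), and the operator is bounded iff its blocks
  are bounded uniformly.

  Rotations in a coordinate plane determine the norms of the monomials up to one constant for each
  degree: \<open>\<parallel>z\<^sup>\<alpha>\<parallel>\<^sup>2 = \<alpha>! A\<^sub>d\<close> for \<open>|\<alpha>| = d\<close>, where \<open>A\<^sub>d = m\<^sub>d / (n (n+1) \<dots> (n+d-1))\<close> (lemma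
  \<open>monomial_norm2_eq\<close>). Put \<open>Y\<^sub>d = A\<^sub>d\<^sub>+\<^sub>1 / A\<^sub>d\<close>, so that \<open>m\<^sub>d\<^sub>+\<^sub>1 / m\<^sub>d = (n+d) Y\<^sub>d\<close>. For a multi-index \<open>\<delta>\<close>
  of degree \<open>d\<close>, with \<open>w\<^sub>j = \<delta>\<^sub>j + 1\<close>, the form \<open>\<omega> = \<Sum>\<^sub>j u\<^sub>j z\<^sup>\<delta>\<^sup>+\<^sup>e\<^sup>j dz\<^sup>*\<^sub>j\<close> satisfies

    \<open>\<parallel>S \<omega>\<parallel>\<^sup>2 = \<delta>! A\<^sub>d\<^sub>+\<^sub>1 ((Y\<^sub>d\<^sub>+\<^sub>1 - Y\<^sub>d) |\<Sum>\<^sub>j u\<^sub>j w\<^sub>j|\<^sup>2 + Y\<^sub>d\<^sub>+\<^sub>1 \<Sum>\<^sub>j |u\<^sub>j|\<^sup>2 w\<^sub>j)\<close>, \<open>\<parallel>\<omega>\<parallel>\<^sup>2 = \<delta>! A\<^sub>d\<^sub>+\<^sub>1 \<Sum>\<^sub>j |u\<^sub>j|\<^sup>2 w\<^sub>j\<close>.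

  Hence \<open>S\<^sup>*S\<close> has on this block the eigenvalue \<open>X\<^sub>d = (n+d+1) Y\<^sub>d\<^sub>+\<^sub>1 - (n+d) Y\<^sub>d\<close> at constant \<open>u\<close>, and the
  eigenvalue \<open>Y\<^sub>d\<^sub>+\<^sub>1\<close> on the \<open>(n-1)\<close>-dimensional orthogonal complement. The weights with an entry \<open>-1\<close>
  give one-dimensional blocks, spanned by \<open>z\<^sup>\<alpha> dz\<^sup>*\<^sub>j\<close> with \<open>\<alpha>\<^sub>j = 0\<close>, on which \<open>S\<^sup>*S\<close> is \<open>Y\<^sub>|\<^sub>\<alpha>\<^sub>|\<close>;
  if \<open>|\<alpha>| \<ge> 1\<close>, this forces \<open>n \<ge> 2\<close>, and the same number is an eigenvalue on the blocks of the first kind.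

  The expression in the theorem, at \<open>d + 1\<close>, is \<open>X\<^sub>d + (n-1) Y\<^sub>d\<^sub>+\<^sub>1\<close>: the trace of \<open>S\<^sup>*S\<close> on the block. All
  eigenvalues are nonnegative, so the traces are bounded iff the eigenvalues are. What
  remains is soft: the canonical solution operator exists and is unique up to null sets, and a
  bounded operator on polynomial forms extends to their closure because \<open>L\<^sup>2\<close> is complete.
\<close>

section \<open>Square integrable functions\<close>

lemma cnj_borel_measurable [measurable (raw)]:
  "f \<in> borel_measurable M \<Longrightarrow> (\<lambda>z. cnj (f z)) \<in> borel_measurable M"
  by (rule measurable_compose[OF _ borel_measurable_continuous_onI]) (auto intro: continuous_intros)

lemma L2_measurable: "f \<in> L2 M \<Longrightarrow> f \<in> borel_measurable M"
  by (simp add: L2_def)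

lemma L2_square_integrable: "f \<in> L2 M \<Longrightarrow> integrable M (\<lambda>z. (cmod (f z))\<^sup>2)"
  by (simp add: L2_def)

lemma L2_abs_mult_integrable:
  assumes f: "f \<in> L2 M" and g: "g \<in> L2 M"
  shows "integrable M (\<lambda>z. cmod (f z) * cmod (g z))"
proof (rule Bochner_Integration.integrable_bound)
  show "integrable M (\<lambda>z. (cmod (f z))\<^sup>2 + (cmod (g z))\<^sup>2)"
    using f g by (intro Bochner_Integration.integrable_add L2_square_integrable)
  show "(\<lambda>z. cmod (f z) * cmod (g z)) \<in> borel_measurable M"
    using L2_measurable[OF f] L2_measurable[OF g] by measurable
  have "a * b \<le> a\<^sup>2 + b\<^sup>2" if "0 \<le> a" "0 \<le> b" for a b :: real
    using sum_squares_bound[of a b] mult_nonneg_nonneg[OF that] by linarith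
  then show "AE z in M. norm (cmod (f z) * cmod (g z)) \<le> norm ((cmod (f z))\<^sup>2 + (cmod (g z))\<^sup>2)"
    by (simp add: abs_mult)
qed

lemma L2_mult_integrable:
  assumes f: "f \<in> L2 M" and g: "g \<in> L2 M"
  shows "integrable M (\<lambda>z. f z * cnj (g z))"
proof (rule Bochner_Integration.integrable_bound[OF L2_abs_mult_integrable[OF f g]])
  show "(\<lambda>z. f z * cnj (g z)) \<in> borel_measurable M"
    using L2_measurable[OF f] L2_measurable[OF g] by measurable
qed (simp add: norm_mult)

lemma L2_add:
  assumes f: "f \<in> L2 M" and g: "g \<in> L2 M"
  shows "(\<lambda>z. f z + g z) \<in> L2 M"
proof -
  have m: "(\<lambda>z. f z + g z) \<in> borel_measurable M"
    using L2_measurable[OF f] L2_measurable[OF g] by measurable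
  have "integrable M (\<lambda>z. (cmod (f z + g z))\<^sup>2)"
  proof (rule Bochner_Integration.integrable_bound)
    show "integrable M (\<lambda>z. (cmod (f z))\<^sup>2 + (cmod (g z))\<^sup>2 + 2 * (cmod (f z) * cmod (g z)))"
      by (intro Bochner_Integration.integrable_add L2_square_integrable f g
          integrable_mult_right L2_abs_mult_integrable)
    show "(\<lambda>z. (cmod (f z + g z))\<^sup>2) \<in> borel_measurable M"
      using m by measurable
    have "(cmod (a + b))\<^sup>2 \<le> (cmod a)\<^sup>2 + (cmod b)\<^sup>2 + 2 * (cmod a * cmod b)" for a b
      using power_mono[OF norm_triangle_ineq[of a b], of 2] by (simp add: power2_eq_square algebra_simps)
    then show "AE z in M. norm ((cmod (f z + g z))\<^sup>2)
        \<le> norm ((cmod (f z))\<^sup>2 + (cmod (g z))\<^sup>2 + 2 * (cmod (f z) * cmod (g z)))"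
      by (simp add: abs_mult)
  qed
  with m show ?thesis by (simp add: L2_def)
qed

lemma L2_scale:
  assumes f: "f \<in> L2 M"
  shows "(\<lambda>z. a * f z) \<in> L2 M"
proof -
  have "(\<lambda>z. a * f z) \<in> borel_measurable M"
    using L2_measurable[OF f] by measurable
  then show ?thesis
    using L2_square_integrable[OF f] by (simp add: L2_def norm_mult power_mult_distrib)
qed

lemma L2_diff: "f \<in> L2 M \<Longrightarrow> g \<in> L2 M \<Longrightarrow> (\<lambda>z. f z - g z) \<in> L2 M"
  using L2_add[of f M "\<lambda>z. -1 * g z"] L2_scale[of g M "-1"] by simp

lemma L2_zero: "(\<lambda>z. 0) \<in> L2 M"
  by (simp add: L2_def)

lemma L2_sum: "(\<And>i. i \<in> I \<Longrightarrow> f i \<in> L2 M) \<Longrightarrow> (\<lambda>z. \<Sum>i\<in>I. f i z) \<in> L2 M"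
  by (induction I rule: infinite_finite_induct) (auto intro: L2_add L2_zero)

lemma L2_norm_nonneg: "0 \<le> L2_norm M f"
  by (simp add: L2_norm_def)

lemma L2_norm_square: "(L2_norm M f)\<^sup>2 = (\<integral>z. (cmod (f z))\<^sup>2 \<partial>M)"
  by (simp add: L2_norm_def)

lemma L2_norm_cong_AE:
  assumes "f \<in> borel_measurable M" "g \<in> borel_measurable M" "AE z in M. f z = g z"
  shows "L2_norm M f = L2_norm M g"
proof -
  have "(\<integral>z. (cmod (f z))\<^sup>2 \<partial>M) = (\<integral>z. (cmod (g z))\<^sup>2 \<partial>M)"
    using assms by (intro integral_cong_AE) auto
  then show ?thesis by (simp add: L2_norm_def)
qed

lemma L2_norm_eq_0_AE:
  assumes f: "f \<in> L2 M" and 0: "L2_norm M f = 0"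
  shows "AE z in M. f z = 0"
proof -
  have "(\<integral>z. (cmod (f z))\<^sup>2 \<partial>M) = 0"
    using 0 L2_norm_square[of M f] by simp
  then show ?thesis
    using integral_nonneg_eq_0_iff_AE[OF L2_square_integrable[OF f]] by simp
qed

lemma L2_norm_scale: "L2_norm M (\<lambda>z. a * f z) = cmod a * L2_norm M f"
  by (simp add: L2_norm_def norm_mult power_mult_distrib real_sqrt_mult)

lemma L2_norm_minus_commute: "L2_norm M (\<lambda>z. f z - g z) = L2_norm M (\<lambda>z. g z - f z)"
  by (simp add: L2_norm_def norm_minus_commute)

lemma L2_norm_zero: "L2_norm M (\<lambda>z. 0) = 0"
  by (simp add: L2_norm_def)

text \<open>
  The Cauchy--Schwarz inequality with absolute values inside the integral. This form also bounds
  \<open>L\<^sup>1\<close> norms on a finite measure space, by taking one factor constant.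
\<close>

lemma integral_mult_le_L2_norm:
  assumes f: "f \<in> L2 M" and g: "g \<in> L2 M"
  shows "(\<integral>z. cmod (f z) * cmod (g z) \<partial>M) \<le> L2_norm M f * L2_norm M g"
proof -
  let ?I = "\<integral>z. cmod (f z) * cmod (g z) \<partial>M"
  have [measurable]: "f \<in> borel_measurable M" "g \<in> borel_measurable M"
    using f g by (simp_all add: L2_measurable)
  have sq: "(\<integral>\<^sup>+z. (ennreal (cmod (h z)))\<^sup>2 \<partial>M) = ennreal ((L2_norm M h)\<^sup>2)" if "h \<in> L2 M" for h
    using nn_integral_eq_integral[OF L2_square_integrable[OF that]]
    by (simp add: L2_norm_square ennreal_power)
  have "(\<integral>\<^sup>+z. ennreal (cmod (f z)) * ennreal (cmod (g z)) \<partial>M) = ennreal ?I"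
    using nn_integral_eq_integral[OF L2_abs_mult_integrable[OF f g]]
    by (simp add: ennreal_mult)
  then have "(ennreal ?I)\<^sup>2 \<le> ennreal ((L2_norm M f)\<^sup>2) * ennreal ((L2_norm M g)\<^sup>2)"
    using Cauchy_Schwarz_nn_integral[of "\<lambda>z. ennreal (cmod (f z))" M "\<lambda>z. ennreal (cmod (g z))"]
      sq[OF f] sq[OF g] by simp
  then have "ennreal (?I\<^sup>2) \<le> ennreal ((L2_norm M f * L2_norm M g)\<^sup>2)"
    by (simp add: ennreal_power ennreal_mult'' power_mult_distrib)
  then have "?I\<^sup>2 \<le> (L2_norm M f * L2_norm M g)\<^sup>2"
    by (subst (asm) ennreal_le_iff) auto
  then show ?thesis
    by (rule power2_le_imp_le) (simp add: L2_norm_nonneg)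
qed

lemma L2_Cauchy_Schwarz:
  assumes f: "f \<in> L2 M" and g: "g \<in> L2 M"
  shows "cmod (L2_inner M f g) \<le> L2_norm M f * L2_norm M g"
proof -
  have "cmod (L2_inner M f g) \<le> (\<integral>z. cmod (f z * cnj (g z)) \<partial>M)"
    unfolding L2_inner_def by (rule integral_norm_bound)
  also have "\<dots> \<le> L2_norm M f * L2_norm M g"
    using integral_mult_le_L2_norm[OF f g] by (simp add: norm_mult)
  finally show ?thesis .
qed

lemma L2_triangle:
  assumes f: "f \<in> L2 M" and g: "g \<in> L2 M"
  shows "L2_norm M (\<lambda>z. f z + g z) \<le> L2_norm M f + L2_norm M g"
proof -
  have "(L2_norm M (\<lambda>z. f z + g z))\<^sup>2
      \<le> (\<integral>z. (cmod (f z))\<^sup>2 + (cmod (g z))\<^sup>2 + 2 * (cmod (f z) * cmod (g z)) \<partial>M)"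
    unfolding L2_norm_square
  proof (rule integral_mono)
    show "integrable M (\<lambda>z. (cmod (f z + g z))\<^sup>2)"
      using L2_add[OF f g] by (rule L2_square_integrable)
    show "integrable M (\<lambda>z. (cmod (f z))\<^sup>2 + (cmod (g z))\<^sup>2 + 2 * (cmod (f z) * cmod (g z)))"
      by (intro Bochner_Integration.integrable_add L2_square_integrable f g
          integrable_mult_right L2_abs_mult_integrable)
    show "(cmod (f z + g z))\<^sup>2 \<le> (cmod (f z))\<^sup>2 + (cmod (g z))\<^sup>2 + 2 * (cmod (f z) * cmod (g z))" for z
      using power_mono[OF norm_triangle_ineq[of "f z" "g z"], of 2]
      by (simp add: power2_eq_square algebra_simps)
  qed
  also have "\<dots> = (L2_norm M f)\<^sup>2 + (L2_norm M g)\<^sup>2 + 2 * (\<integral>z. cmod (f z) * cmod (g z) \<partial>M)"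
    unfolding L2_norm_square
    using L2_square_integrable[OF f] L2_square_integrable[OF g] L2_abs_mult_integrable[OF f g]
    by simp
  also have "\<dots> \<le> (L2_norm M f + L2_norm M g)\<^sup>2"
    using integral_mult_le_L2_norm[OF f g] by (simp add: power2_sum)
  finally show ?thesis
    by (rule power2_le_imp_le) (simp add: L2_norm_nonneg)
qed

lemma L2_inner_self:
  "L2_inner M f f = of_real ((L2_norm M f)\<^sup>2)"
proof -
  have "L2_inner M f f = (\<integral>z. of_real ((cmod (f z))\<^sup>2) \<partial>M)"
    unfolding L2_inner_def by (simp only: complex_norm_square)
  then show ?thesis by (simp only: L2_norm_square integral_complex_of_real)
qed

lemma L2_inner_cnj: "cnj (L2_inner M f g) = L2_inner M g f"
proof -
  have "cnj (L2_inner M f g) = (\<integral>z. cnj (f z * cnj (g z)) \<partial>M)"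
    unfolding L2_inner_def by (rule Bochner_Integration.integral_cnj[symmetric])
  then show ?thesis by (simp add: L2_inner_def mult.commute)
qed

lemma L2_inner_diff_left:
  assumes "f \<in> L2 M" "g \<in> L2 M" "h \<in> L2 M"
  shows "L2_inner M (\<lambda>z. f z - g z) h = L2_inner M f h - L2_inner M g h"
  unfolding L2_inner_def using assms by (simp add: left_diff_distrib L2_mult_integrable)

lemma L2_inner_diff_right:
  assumes "f \<in> L2 M" "g \<in> L2 M" "h \<in> L2 M"
  shows "L2_inner M h (\<lambda>z. f z - g z) = L2_inner M h f - L2_inner M h g"
  unfolding L2_inner_def using assms by (simp add: right_diff_distrib L2_mult_integrable)

lemma L2_inner_add_left:
  assumes "f \<in> L2 M" "g \<in> L2 M" "h \<in> L2 M"
  shows "L2_inner M (\<lambda>z. f z + g z) h = L2_inner M f h + L2_inner M g h"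
  unfolding L2_inner_def using assms by (simp add: distrib_right L2_mult_integrable)

lemma L2_inner_scale_left: "L2_inner M (\<lambda>z. a * f z) h = a * L2_inner M f h"
  unfolding L2_inner_def by (simp add: mult.assoc)

lemma L2_inner_scale_right: "L2_inner M h (\<lambda>z. a * f z) = cnj a * L2_inner M h f"
  using L2_inner_scale_left[of M a f h] by (metis L2_inner_cnj complex_cnj_mult)

lemma L2_inner_sum_left:
  assumes "\<And>i. i \<in> I \<Longrightarrow> f i \<in> L2 M" "h \<in> L2 M"
  shows "L2_inner M (\<lambda>z. \<Sum>i\<in>I. f i z) h = (\<Sum>i\<in>I. L2_inner M (f i) h)"
  unfolding L2_inner_def using assms
  by (simp add: sum_distrib_right L2_mult_integrable)

lemma L2_inner_sum_right:
  assumes "\<And>i. i \<in> I \<Longrightarrow> f i \<in> L2 M" "h \<in> L2 M"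
  shows "L2_inner M h (\<lambda>z. \<Sum>i\<in>I. f i z) = (\<Sum>i\<in>I. L2_inner M h (f i))"
proof -
  have "L2_inner M h (\<lambda>z. \<Sum>i\<in>I. f i z) = cnj (\<Sum>i\<in>I. L2_inner M (f i) h)"
    using L2_inner_sum_left[of I f M h] assms by (metis L2_inner_cnj)
  then show ?thesis by (simp add: L2_inner_cnj)
qed

lemma L2_Pythagoras:
  assumes fin: "finite I" and f: "\<And>i. i \<in> I \<Longrightarrow> f i \<in> L2 M"
    and orth: "\<And>i k. i \<in> I \<Longrightarrow> k \<in> I \<Longrightarrow> i \<noteq> k \<Longrightarrow> L2_inner M (f i) (f k) = 0"
  shows "(L2_norm M (\<lambda>z. \<Sum>i\<in>I. f i z))\<^sup>2 = (\<Sum>i\<in>I. (L2_norm M (f i))\<^sup>2)"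
proof -
  have "complex_of_real ((L2_norm M (\<lambda>z. \<Sum>i\<in>I. f i z))\<^sup>2) = (\<Sum>i\<in>I. L2_inner M (f i) (\<lambda>z. \<Sum>k\<in>I. f k z))"
    unfolding L2_inner_self[symmetric] using f by (intro L2_inner_sum_left L2_sum)
  also have "\<dots> = (\<Sum>i\<in>I. \<Sum>k\<in>I. L2_inner M (f i) (f k))"
    using f by (intro sum.cong refl L2_inner_sum_right)
  also have "\<dots> = (\<Sum>i\<in>I. \<Sum>k\<in>I. if k = i then L2_inner M (f i) (f i) else 0)"
    using orth by (intro sum.cong refl) auto
  also have "\<dots> = (\<Sum>i\<in>I. L2_inner M (f i) (f i))"
    using fin by simp
  also have "\<dots> = complex_of_real (\<Sum>i\<in>I. (L2_norm M (f i))\<^sup>2)"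
    unfolding L2_inner_self by (rule of_real_sum[symmetric])
  finally show ?thesis by (simp only: of_real_eq_iff)
qed

text \<open>
  The Riesz--Fischer argument: if the steps of a sequence decay geometrically in norm, the sequence
  of functions converges almost everywhere, because the sum of the absolute values of the steps is
  integrable on a finite measure space; Fatou's lemma turns this into convergence in norm.
\<close>

lemma L2_complete:
  assumes fin: "finite_measure M" and g: "\<And>n. g n \<in> L2 M"
    and step: "\<And>n. L2_norm M (\<lambda>z. g (Suc n) z - g n z) \<le> (1/2) ^ n"
  obtains h where "h \<in> L2 M" "(\<lambda>n. L2_norm M (\<lambda>z. g n z - h z)) \<longlonglongrightarrow> 0"
proof -
  interpret finite_measure M by fact
  have [measurable]: "g n \<in> borel_measurable M" for n
    using g by (rule L2_measurable)
  have one: "(\<lambda>_. 1) \<in> L2 M" by (simp add: L2_def)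
  have gd: "(\<lambda>z. g n z - g k z) \<in> L2 M" for n k
    using g by (intro L2_diff)
  define d where "d n z = cmod (g (Suc n) z - g n z)" for n z
  have d_meas [measurable]: "d n \<in> borel_measurable M" for n
    unfolding d_def by measurable
  define K where "K = L2_norm M (\<lambda>_. 1)"
  have K0: "0 \<le> K" by (simp add: K_def L2_norm_nonneg)
  have d_int: "integrable M (d n)" and d_le: "(\<integral>z. d n z \<partial>M) \<le> K * (1/2) ^ n" for n
  proof -
    show "integrable M (d n)"
      using L2_abs_mult_integrable[OF gd one] by (simp add: d_def[abs_def])
    have "(\<integral>z. d n z \<partial>M) \<le> L2_norm M (\<lambda>z. g (Suc n) z - g n z) * K"
      using integral_mult_le_L2_norm[OF gd one, of "Suc n" n] by (simp add: d_def K_def)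
    also have "\<dots> \<le> (1/2) ^ n * K"
      using step[of n] K0 by (intro mult_right_mono)
    finally show "(\<integral>z. d n z \<partial>M) \<le> K * (1/2) ^ n" by (simp add: mult.commute)
  qed
  have "(\<integral>\<^sup>+z. (\<Sum>n. ennreal (d n z)) \<partial>M) = (\<Sum>n. \<integral>\<^sup>+z. ennreal (d n z) \<partial>M)"
    by (rule nn_integral_suminf) simp
  also have "\<dots> \<le> (\<Sum>n. ennreal (K * (1/2) ^ n))"
  proof (rule suminf_le)
    fix n
    have "(\<integral>\<^sup>+z. ennreal (d n z) \<partial>M) = ennreal (\<integral>z. d n z \<partial>M)"
      by (rule nn_integral_eq_integral[OF d_int]) (simp add: d_def)
    then show "(\<integral>\<^sup>+z. ennreal (d n z) \<partial>M) \<le> ennreal (K * (1/2) ^ n)"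
      using d_le by (simp add: ennreal_leI)
  qed auto
  also have "\<dots> = ennreal (\<Sum>n. K * (1/2) ^ n)"
    using K0 by (intro suminf_ennreal2 summable_mult summable_geometric) auto
  also have "\<dots> < \<infinity>" by simp
  finally have "AE z in M. (\<Sum>n. ennreal (d n z)) \<noteq> \<infinity>"
    by (intro nn_integral_PInf_AE) auto
  then have conv: "AE z in M. convergent (\<lambda>n. g n z)"
  proof (rule AE_mp, intro AE_I2 impI)
    fix z assume "(\<Sum>n. ennreal (d n z)) \<noteq> \<infinity>"
    then have "summable (\<lambda>n. d n z)"
      by (intro summable_suminf_not_top) (auto simp: d_def)
    then have "summable (\<lambda>n. g (Suc n) z - g n z)"
      unfolding d_def by (rule summable_norm_cancel)
    then have "convergent (\<lambda>n. \<Sum>k<n. g (Suc k) z - g k z)"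
      by (simp add: summable_iff_convergent)
    then have "convergent (\<lambda>n. g n z - g 0 z)"
      by (simp only: sum_lessThan_telescope[of "\<lambda>n. g n z"])
    then obtain l where "(\<lambda>n. g n z - g 0 z) \<longlonglongrightarrow> l" by (auto simp: convergent_def)
    then have "(\<lambda>n. g n z - g 0 z + g 0 z) \<longlonglongrightarrow> l + g 0 z" by (intro tendsto_intros)
    then show "convergent (\<lambda>n. g n z)" by (auto simp: convergent_def)
  qed
  define h where "h z = lim (\<lambda>n. g n z)" for z
  have h_meas [measurable]: "h \<in> borel_measurable M"
    unfolding h_def[abs_def] by (rule borel_measurable_lim_metric) simp
  have far: "L2_norm M (\<lambda>z. g (n + k) z - g n z) \<le> 2 * (1/2) ^ n" for n k
  proof -
    have "L2_norm M (\<lambda>z. g (n + k) z - g n z) \<le> 2 * (1/2) ^ n * (1 - (1/2) ^ k)"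
    proof (induction k)
      case 0
      then show ?case by (simp add: L2_norm_zero)
    next
      case (Suc k)
      have "L2_norm M (\<lambda>z. g (n + Suc k) z - g n z)
          = L2_norm M (\<lambda>z. (g (Suc (n + k)) z - g (n + k) z) + (g (n + k) z - g n z))"
        by simp
      also have "\<dots> \<le> L2_norm M (\<lambda>z. g (Suc (n + k)) z - g (n + k) z)
          + L2_norm M (\<lambda>z. g (n + k) z - g n z)"
        by (rule L2_triangle[OF gd gd])
      also have "\<dots> \<le> (1/2) ^ (n + k) + 2 * (1/2) ^ n * (1 - (1/2) ^ k)"
        using step Suc.IH by (rule add_mono)
      also have "\<dots> = 2 * (1/2) ^ n * (1 - (1/2) ^ Suc k)"
        by (simp add: power_add algebra_simps)
      finally show ?case .
    qed
    also have "\<dots> \<le> 2 * (1/2) ^ n" by (simp add: mult_left_le)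
    finally show ?thesis .
  qed
  have fatou: "(\<integral>\<^sup>+z. ennreal ((cmod (g n z - h z))\<^sup>2) \<partial>M) \<le> ennreal ((2 * (1/2) ^ n)\<^sup>2)" for n
  proof -
    have "(\<integral>\<^sup>+z. ennreal ((cmod (g n z - h z))\<^sup>2) \<partial>M)
        = (\<integral>\<^sup>+z. liminf (\<lambda>k. ennreal ((cmod (g (n + k) z - g n z))\<^sup>2)) \<partial>M)"
    proof (rule nn_integral_cong_AE, rule AE_mp[OF conv], intro AE_I2 impI)
      fix z assume "convergent (\<lambda>n. g n z)"
      then have "(\<lambda>n. g n z) \<longlonglongrightarrow> h z"
        by (simp add: convergent_LIMSEQ_iff h_def)
      then have "(\<lambda>k. g (n + k) z) \<longlonglongrightarrow> h z"
        using LIMSEQ_ignore_initial_segment[of "\<lambda>n. g n z" "h z" n] by (simp add: add.commute)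
      then have "(\<lambda>k. ennreal ((cmod (g (n + k) z - g n z))\<^sup>2)) \<longlonglongrightarrow> ennreal ((cmod (h z - g n z))\<^sup>2)"
        by (intro tendsto_intros)
      then show "ennreal ((cmod (g n z - h z))\<^sup>2) = liminf (\<lambda>k. ennreal ((cmod (g (n + k) z - g n z))\<^sup>2))"
        using lim_imp_Liminf[OF trivial_limit_sequentially] by (metis norm_minus_commute)
    qed
    also have "\<dots> \<le> liminf (\<lambda>k. \<integral>\<^sup>+z. ennreal ((cmod (g (n + k) z - g n z))\<^sup>2) \<partial>M)"
      by (rule nn_integral_liminf) simp
    also have "\<dots> \<le> limsup (\<lambda>k. \<integral>\<^sup>+z. ennreal ((cmod (g (n + k) z - g n z))\<^sup>2) \<partial>M)"
      by (rule Liminf_le_Limsup) simp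
    also have "\<dots> \<le> ennreal ((2 * (1/2) ^ n)\<^sup>2)"
    proof (rule Limsup_bounded, rule always_eventually, rule allI)
      fix k
      have "(\<integral>\<^sup>+z. ennreal ((cmod (g (n + k) z - g n z))\<^sup>2) \<partial>M)
          = ennreal ((L2_norm M (\<lambda>z. g (n + k) z - g n z))\<^sup>2)"
        using nn_integral_eq_integral[OF L2_square_integrable[OF gd]] by (simp add: L2_norm_square)
      also have "\<dots> \<le> ennreal ((2 * (1/2) ^ n)\<^sup>2)"
        using far L2_norm_nonneg by (intro ennreal_leI power_mono)
      finally show "(\<integral>\<^sup>+z. ennreal ((cmod (g (n + k) z - g n z))\<^sup>2) \<partial>M) \<le> ennreal ((2 * (1/2) ^ n)\<^sup>2)" .
    qed
    finally show ?thesis .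
  qed
  have gh: "(\<lambda>z. g n z - h z) \<in> L2 M" for n
  proof -
    have "(\<integral>\<^sup>+z. ennreal (norm ((cmod (g n z - h z))\<^sup>2)) \<partial>M) < \<infinity>"
      using fatou[of n] by (simp add: le_less_trans)
    then show ?thesis by (simp add: L2_def integrable_iff_bounded)
  qed
  have bound: "L2_norm M (\<lambda>z. g n z - h z) \<le> 2 * (1/2) ^ n" for n
  proof (rule power2_le_imp_le)
    have "ennreal ((L2_norm M (\<lambda>z. g n z - h z))\<^sup>2) \<le> ennreal ((2 * (1/2) ^ n)\<^sup>2)"
      using fatou[of n] nn_integral_eq_integral[OF L2_square_integrable[OF gh]]
      by (simp add: L2_norm_square)
    then show "(L2_norm M (\<lambda>z. g n z - h z))\<^sup>2 \<le> (2 * (1/2) ^ n)\<^sup>2"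
      by (subst (asm) ennreal_le_iff) auto
  qed simp
  have "h \<in> L2 M"
    using L2_diff[OF g[of 0] gh[of 0]] by simp
  moreover have "(\<lambda>n. L2_norm M (\<lambda>z. g n z - h z)) \<longlonglongrightarrow> 0"
  proof (rule tendsto_sandwich[OF always_eventually always_eventually])
    show "\<forall>n. 0 \<le> L2_norm M (\<lambda>z. g n z - h z)" by (simp add: L2_norm_nonneg)
    show "\<forall>n. L2_norm M (\<lambda>z. g n z - h z) \<le> 2 * (1/2) ^ n" using bound by simp
    show "(\<lambda>n. 2 * (1/2::real) ^ n) \<longlonglongrightarrow> 0"
      by (rule tendsto_mult_right_zero, rule LIMSEQ_power_zero) simp
  qed simp
  ultimately show ?thesis by (rule that)
qed

section \<open>Functions of polynomial growth\<close>

text \<open>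
  All integrands built from monomials and their conjugates have polynomial growth, and finiteness of
  the moments makes every such function integrable; a single closure calculus then
  settles all questions of integrability.
\<close>

definition poly_growth :: "('a::real_normed_vector \<Rightarrow> complex) \<Rightarrow> bool" where
  "poly_growth f \<longleftrightarrow> f \<in> borel_measurable borel \<and> (\<exists>C N. \<forall>z. cmod (f z) \<le> C * (1 + norm z) ^ N)"

lemma poly_growth_measurable: "poly_growth f \<Longrightarrow> f \<in> borel_measurable borel"
  by (simp add: poly_growth_def)

lemma poly_growth_bound:
  assumes "poly_growth f"
  shows "\<exists>C N. 0 \<le> C \<and> (\<forall>z. cmod (f z) \<le> C * (1 + norm z) ^ N)"
proof -
  obtain C N where *: "\<And>z. cmod (f z) \<le> C * (1 + norm z) ^ N"
    using assms by (auto simp: poly_growth_def)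
  have "0 \<le> C" using order_trans[OF norm_ge_zero *[of 0]] by simp
  with * show ?thesis by blast
qed

lemma poly_growth_const [simp]: "poly_growth (\<lambda>z. c)"
  unfolding poly_growth_def by (rule conjI, simp, rule exI[of _ "cmod c"], rule exI[of _ 0]) simp

lemma poly_growth_coord [simp]: "poly_growth (\<lambda>z::complex^'n. z $ i)"
proof -
  have "(\<lambda>z::complex^'n. z $ i) \<in> borel_measurable borel"
    by (intro borel_measurable_continuous_onI continuous_intros)
  moreover have "cmod (z $ i) \<le> 1 * (1 + norm z) ^ 1" for z :: "complex^'n"
    using Finite_Cartesian_Product.norm_nth_le[of z i] by simp
  ultimately show ?thesis unfolding poly_growth_def by blast
qed

lemma poly_growth_cnj:
  assumes "poly_growth f" shows "poly_growth (\<lambda>z. cnj (f z))"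
proof -
  have "(\<lambda>z. cnj (f z)) \<in> borel_measurable borel"
    using poly_growth_measurable[OF assms] by measurable
  then show ?thesis using assms by (simp add: poly_growth_def)
qed

lemma poly_growth_mult:
  assumes f: "poly_growth f" and g: "poly_growth g"
  shows "poly_growth (\<lambda>z. f z * g z)"
proof -
  have "(\<lambda>z. f z * g z) \<in> borel_measurable borel"
    using poly_growth_measurable[OF f] poly_growth_measurable[OF g] by measurable
  moreover obtain C N where C: "0 \<le> C" "\<And>z. cmod (f z) \<le> C * (1 + norm z) ^ N"
    using poly_growth_bound[OF f] by blast
  moreover obtain D K where D: "0 \<le> D" "\<And>z. cmod (g z) \<le> D * (1 + norm z) ^ K"
    using poly_growth_bound[OF g] by blast
  have "cmod (f z * g z) \<le> (C * D) * (1 + norm z) ^ (N + K)" for z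
    using mult_mono[OF C(2)[of z] D(2)[of z]] C(1) by (simp add: norm_mult power_add mult_ac)
  ultimately show ?thesis unfolding poly_growth_def by blast
qed

lemma poly_growth_add:
  assumes f: "poly_growth f" and g: "poly_growth g"
  shows "poly_growth (\<lambda>z. f z + g z)"
proof -
  have "(\<lambda>z. f z + g z) \<in> borel_measurable borel"
    using poly_growth_measurable[OF f] poly_growth_measurable[OF g] by measurable
  moreover obtain C N where C: "0 \<le> C" "\<And>z. cmod (f z) \<le> C * (1 + norm z) ^ N"
    using poly_growth_bound[OF f] by blast
  moreover obtain D K where D: "0 \<le> D" "\<And>z. cmod (g z) \<le> D * (1 + norm z) ^ K"
    using poly_growth_bound[OF g] by blast
  have "cmod (f z + g z) \<le> (C + D) * (1 + norm z) ^ (N + K)" for z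
  proof -
    have "cmod (f z + g z) \<le> C * (1 + norm z) ^ N + D * (1 + norm z) ^ K"
      using C(2)[of z] D(2)[of z] norm_triangle_ineq[of "f z" "g z"] by linarith
    also have "\<dots> \<le> C * (1 + norm z) ^ (N + K) + D * (1 + norm z) ^ (N + K)"
      using C(1) D(1) by (intro add_mono mult_left_mono power_increasing) auto
    finally show ?thesis by (simp add: distrib_right)
  qed
  ultimately show ?thesis unfolding poly_growth_def by blast
qed

lemma poly_growth_diff:
  "poly_growth f \<Longrightarrow> poly_growth g \<Longrightarrow> poly_growth (\<lambda>z. f z - g z)"
  using poly_growth_add[of f "\<lambda>z. -1 * g z"] poly_growth_mult[of "\<lambda>z. -1" g] by simp

lemma poly_growth_sum:
  "(\<And>i. i \<in> I \<Longrightarrow> poly_growth (f i)) \<Longrightarrow> poly_growth (\<lambda>z. \<Sum>i\<in>I. f i z)"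
  by (induction I rule: infinite_finite_induct) (auto intro: poly_growth_add)

lemma poly_growth_power: "poly_growth f \<Longrightarrow> poly_growth (\<lambda>z. f z ^ k)"
  by (induction k) (auto intro: poly_growth_mult)

lemma poly_growth_prod:
  "(\<And>i. i \<in> I \<Longrightarrow> poly_growth (f i)) \<Longrightarrow> poly_growth (\<lambda>z. \<Prod>i\<in>I. f i z)"
  by (induction I rule: infinite_finite_induct) (auto intro: poly_growth_mult)

lemma poly_growth_monomial: "poly_growth (monomial \<alpha>)"
  unfolding monomial_def[abs_def] by (intro poly_growth_prod poly_growth_power poly_growth_coord)

lemmas poly_growth_intros = poly_growth_const poly_growth_coord poly_growth_cnj poly_growth_mult
  poly_growth_add poly_growth_diff poly_growth_sum poly_growth_power poly_growth_prod
  poly_growth_monomial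

text \<open>
  Polynomials in a real parameter whose coefficients depend on a point of the space; they describe
  how an integrand varies along a one-parameter family of rotations.
\<close>

definition coeffs_poly_growth :: "('a::real_normed_vector \<Rightarrow> complex poly) \<Rightarrow> bool" where
  "coeffs_poly_growth P \<longleftrightarrow> (\<forall>i. poly_growth (\<lambda>z. coeff (P z) i))"

lemma coeffs_poly_growth_pCons:
  assumes "poly_growth f" "coeffs_poly_growth P"
  shows "coeffs_poly_growth (\<lambda>z. pCons (f z) (P z))"
  unfolding coeffs_poly_growth_def
proof
  fix i
  show "poly_growth (\<lambda>z. coeff (pCons (f z) (P z)) i)"
    using assms by (cases i) (auto simp: coeffs_poly_growth_def)
qed

lemma coeffs_poly_growth_0: "coeffs_poly_growth (\<lambda>z. 0)"
  by (simp add: coeffs_poly_growth_def)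

lemma coeffs_poly_growth_mult:
  assumes "coeffs_poly_growth P" "coeffs_poly_growth Q"
  shows "coeffs_poly_growth (\<lambda>z. P z * Q z)"
  using assms unfolding coeffs_poly_growth_def coeff_mult
  by (intro allI poly_growth_sum poly_growth_mult) auto

lemma coeffs_poly_growth_power:
  assumes "coeffs_poly_growth P"
  shows "coeffs_poly_growth (\<lambda>z. P z ^ k)"
proof (induction k)
  case 0
  have "poly_growth (\<lambda>z. coeff (1::complex poly) i)" for i by simp
  then show ?case by (simp add: coeffs_poly_growth_def)
next
  case (Suc k)
  then show ?case using assms by (simp add: coeffs_poly_growth_mult)
qed

lemma coeff_mult_1: "coeff (p * q) 1 = coeff p 0 * coeff q 1 + coeff p 1 * coeff q 0"
  for p q :: "'a::comm_semiring_1 poly"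
  by (simp add: coeff_mult)

text \<open>
  The coefficient of the linear term is the derivative at the origin, so this is the power rule.
\<close>

lemma coeff_power_1: "coeff (p ^ k) 1 = of_nat k * coeff p 0 ^ (k - 1) * coeff p 1"
  for p :: "'a::comm_semiring_1 poly"
proof (induction k)
  case (Suc k)
  then show ?case
    by (cases k) (simp_all add: coeff_mult_1[unfolded One_nat_def] coeff_0_power coeff_mult_0 algebra_simps)
qed simp

section \<open>Multi-indices\<close>

definition raise :: "'n \<Rightarrow> ('n \<Rightarrow> nat) \<Rightarrow> 'n \<Rightarrow> nat" where
  "raise j \<alpha> = \<alpha>(j := Suc (\<alpha> j))"

definition lower :: "'n \<Rightarrow> ('n \<Rightarrow> nat) \<Rightarrow> 'n \<Rightarrow> nat" where
  "lower j \<alpha> = \<alpha>(j := \<alpha> j - 1)"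

definition total_degree :: "('n::finite \<Rightarrow> nat) \<Rightarrow> nat" where
  "total_degree \<alpha> = (\<Sum>i\<in>UNIV. \<alpha> i)"

definition mfact :: "('n::finite \<Rightarrow> nat) \<Rightarrow> real" where
  "mfact \<alpha> = (\<Prod>i\<in>UNIV. fact (\<alpha> i))"

lemma raise_lower: "\<alpha> j \<noteq> 0 \<Longrightarrow> raise j (lower j \<alpha>) = \<alpha>"
  by (auto simp: raise_def lower_def)

lemma lower_raise [simp]: "lower j (raise j \<alpha>) = \<alpha>"
  by (auto simp: raise_def lower_def)

lemma raise_commute: "raise j (raise k \<alpha>) = raise k (raise j \<alpha>)"
  by (auto simp: raise_def fun_eq_iff)

lemma raise_inject: "raise j \<alpha> = raise j \<beta> \<longleftrightarrow> \<alpha> = \<beta>"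
  by (metis lower_raise)

lemma prod_fun_upd_UNIV:
  fixes f :: "'n::finite \<Rightarrow> 'b \<Rightarrow> 'c::comm_monoid_mult"
  shows "(\<Prod>i\<in>UNIV. f i ((\<alpha>(j := x)) i)) = f j x * (\<Prod>i\<in>UNIV - {j}. f i (\<alpha> i))"
  by (subst prod.remove[of _ j]) (auto intro!: prod.cong)

lemma total_degree_raise [simp]: "total_degree (raise j \<alpha>) = Suc (total_degree \<alpha>)"
proof -
  have "total_degree (raise j \<alpha>) = (\<Sum>i\<in>UNIV. \<alpha> i + (if i = j then 1 else 0))"
    unfolding total_degree_def raise_def by (intro sum.cong) auto
  then show ?thesis by (simp add: sum.distrib total_degree_def)
qed

lemma mfact_raise: "mfact (raise j \<alpha>) = (\<alpha> j + 1) * mfact \<alpha>"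
  unfolding mfact_def raise_def
  by (subst prod_fun_upd_UNIV[where f = "\<lambda>i x. fact x"], subst (2) prod.remove[of _ j]) (auto simp: algebra_simps)

lemma mfact_pos: "0 < mfact \<alpha>"
  by (simp add: mfact_def prod_pos)

lemma monomial_raise: "monomial (raise j \<alpha>) z = z $ j * monomial \<alpha> z"
  unfolding monomial_def raise_def
  by (subst prod_fun_upd_UNIV[where f = "\<lambda>i x. (z $ i) ^ x"], subst (2) prod.remove[of _ j]) auto

lemma monomial_0: "monomial (\<lambda>i. 0) z = 1"
  by (simp add: monomial_def)

section \<open>Moments of a rotation-invariant measure\<close>

locale rotation_invariant_measure =
  fixes M :: "(complex ^ 'n) measure"
  assumes sets_M: "sets M = sets borel"
    and invariant: "rotation_invariant M"
    and moment_pos: "\<And>d. 0 < moment M d"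
    and moment_finite: "\<And>d. moment M d < \<infinity>"
begin

lemma borel_measurable_M: "borel_measurable M = borel_measurable borel"
  by (rule measurable_cong_sets[OF sets_M refl])

lemma norm_power_integrable: "integrable M (\<lambda>z. norm z ^ (2 * d))"
proof -
  have "(\<lambda>z. norm z ^ (2 * d)) \<in> borel_measurable M"
    unfolding borel_measurable_M by measurable
  then show ?thesis
    using moment_finite[of d] by (simp add: integrable_iff_bounded moment_def)
qed

lemma finite_measure_M: "finite_measure M"
proof
  have "emeasure M (space M) = moment M 0" by (simp add: moment_def)
  then show "emeasure M (space M) \<noteq> \<infinity>" using moment_finite[of 0] by simp
qed

lemma poly_growth_integrable:
  assumes "poly_growth f"
  shows "integrable M f"
proof -
  obtain C N where C: "0 \<le> C" "\<And>z. cmod (f z) \<le> C * (1 + norm z) ^ N"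
    using poly_growth_bound[OF assms] by blast
  show ?thesis
  proof (rule Bochner_Integration.integrable_bound)
    show "integrable M (\<lambda>z. C * 4 ^ N * (norm z ^ (2 * 0) + norm z ^ (2 * N)))"
      by (intro integrable_mult_right Bochner_Integration.integrable_add norm_power_integrable)
    show "f \<in> borel_measurable M"
      using poly_growth_measurable[OF assms] by (simp add: borel_measurable_M)
    show "AE z in M. norm (f z) \<le> norm (C * 4 ^ N * (norm z ^ (2 * 0) + norm z ^ (2 * N)))"
    proof (rule AE_I2)
      fix z :: "complex ^ 'n"
      have "(1 + norm z) ^ N \<le> 4 ^ N * (1 + norm z ^ (2 * N))"
      proof (cases "norm z \<le> 1")
        case True
        have "(1 + norm z) ^ N \<le> 4 ^ N * 1"
          using True by (simp add: power_mono)
        also have "\<dots> \<le> 4 ^ N * (1 + norm z ^ (2 * N))"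
          by (intro mult_left_mono) auto
        finally show ?thesis .
      next
        case False
        then have "norm z * 1 \<le> norm z * norm z" by (intro mult_left_mono) auto
        then have "(1 + norm z) ^ N \<le> (4 * (norm z)\<^sup>2) ^ N"
          using False by (intro power_mono) (auto simp: power2_eq_square)
        also have "\<dots> = 4 ^ N * norm z ^ (2 * N)"
          by (simp add: power_mult_distrib power_mult)
        also have "\<dots> \<le> 4 ^ N * (1 + norm z ^ (2 * N))"
          by (intro mult_left_mono) auto
        finally show ?thesis .
      qed
      then have "C * (1 + norm z) ^ N \<le> C * (4 ^ N * (1 + norm z ^ (2 * N)))"
        using C(1) by (rule mult_left_mono)
      then show "norm (f z) \<le> norm (C * 4 ^ N * (norm z ^ (2 * 0) + norm z ^ (2 * N)))"
        using C(1) C(2)[of z] by (simp add: abs_mult mult.assoc)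
    qed
  qed
qed

lemma poly_growth_L2:
  assumes "poly_growth f"
  shows "f \<in> L2 M"
proof -
  have "integrable M (\<lambda>z. cmod (f z * cnj (f z)))"
    using assms by (intro integrable_norm poly_growth_integrable poly_growth_intros)
  then show ?thesis
    using poly_growth_measurable[OF assms]
    by (simp add: L2_def borel_measurable_M norm_mult power2_eq_square)
qed

lemma monomial_L2: "monomial \<alpha> \<in> L2 M"
  by (intro poly_growth_L2 poly_growth_intros)

lemma integral_unitary:
  assumes U: "unitary_matrix U" and f: "f \<in> borel_measurable borel"
  shows "(\<integral>z. f (U *v z) \<partial>M) = (\<integral>z. f z \<partial>M :: complex)"
proof -
  have "(\<lambda>z. U *v z) \<in> borel \<rightarrow>\<^sub>M borel"
    unfolding matrix_vector_mult_def
    by (intro borel_measurable_continuous_onI continuous_intros)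
  then have "(\<lambda>z. U *v z) \<in> M \<rightarrow>\<^sub>M M"
    by (simp add: measurable_cong_sets[OF sets_M sets_M])
  moreover have "distr M M (\<lambda>z. U *v z) = M"
    using invariant U by (simp add: rotation_invariant_def)
  ultimately show ?thesis
    using f integral_distr[of "\<lambda>z. U *v z" M M f] by (simp add: borel_measurable_M)
qed

definition monomial_norm2 :: "('n \<Rightarrow> nat) \<Rightarrow> real" where
  "monomial_norm2 \<alpha> = (\<integral>z. (cmod (monomial \<alpha> z))\<^sup>2 \<partial>M)"

end

text \<open>
  The diagonal matrices with a single entry different from 1 suffice to separate multi-indices.
\<close>

definition coordinate_phase :: "'n::finite \<Rightarrow> complex \<Rightarrow> complex ^ 'n ^ 'n" where
  "coordinate_phase j w = (\<chi> i l. if i = l then (if i = j then w else 1) else 0)"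

lemma coordinate_phase_vector:
  "(coordinate_phase j w *v z) $ i = (if i = j then w else 1) * z $ i"
proof -
  have "(coordinate_phase j w *v z) $ i = (\<Sum>l\<in>UNIV. if l = i then (if i = j then w else 1) * z $ i else 0)"
    unfolding matrix_vector_mult_def coordinate_phase_def vec_lambda_beta
    by (rule sum.cong) auto
  then show ?thesis by simp
qed

lemma coordinate_phase_unitary:
  assumes "cmod w = 1"
  shows "unitary_matrix (coordinate_phase j w)"
proof -
  have adj: "map_matrix cnj (transpose (coordinate_phase j w)) = coordinate_phase j (cnj w)"
    by (auto simp: coordinate_phase_def transpose_def vec_eq_iff)
  have *: "coordinate_phase j u ** coordinate_phase j v = mat 1" if "u * v = 1" for u v
    using that by (auto simp: matrix_eq matrix_vector_mul_assoc[symmetric] vec_eq_iff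
        coordinate_phase_vector simp del: mult.assoc simp: mult.assoc[symmetric])
  have "w * cnj w = 1" using complex_norm_square[of w] assms by simp
  then show ?thesis
    unfolding unitary_matrix_def adj by (simp add: * mult.commute)
qed

lemma monomial_coordinate_phase:
  "monomial \<alpha> (coordinate_phase j w *v z) = w ^ \<alpha> j * monomial \<alpha> z"
proof -
  have "monomial \<alpha> (coordinate_phase j w *v z)
      = (\<Prod>i\<in>UNIV. if i = j then w ^ \<alpha> j else 1) * monomial \<alpha> z"
    unfolding monomial_def coordinate_phase_vector prod.distrib[symmetric]
    by (intro prod.cong) (auto simp: power_mult_distrib)
  then show ?thesis by simp
qed

definition plane_rotation :: "'n::finite \<Rightarrow> 'n \<Rightarrow> real \<Rightarrow> real \<Rightarrow> complex ^ 'n ^ 'n" where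
  "plane_rotation j k c s = (\<chi> i l.
     if i = j then (if l = j then of_real c else if l = k then of_real s else 0)
     else if i = k then (if l = j then - of_real s else if l = k then of_real c else 0)
     else if i = l then 1 else 0)"

lemma plane_rotation_vector:
  assumes "j \<noteq> k"
  shows "(plane_rotation j k c s *v z) $ i =
    (if i = j then of_real c * z $ j + of_real s * z $ k
     else if i = k then of_real c * z $ k - of_real s * z $ j else z $ i)"
proof -
  have two: "(\<Sum>l\<in>UNIV. (if l = j then a else if l = k then b else 0) * z $ l) = a * z $ j + b * z $ k" for a b
  proof -
    have "(\<Sum>l\<in>UNIV. (if l = j then a else if l = k then b else 0) * z $ l)
        = (\<Sum>l\<in>UNIV. (if l = j then a * z $ j else 0) + (if l = k then b * z $ k else 0))"
      using assms by (intro sum.cong) auto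
    then show ?thesis by (simp add: sum.distrib)
  qed
  have one: "(\<Sum>l\<in>UNIV. (if i = l then 1 else 0) * z $ l) = z $ i"
  proof -
    have "(\<Sum>l\<in>UNIV. (if i = l then 1 else 0) * z $ l) = (\<Sum>l\<in>UNIV. if l = i then z $ i else 0)"
      by (intro sum.cong) auto
    then show ?thesis by simp
  qed
  show ?thesis
    unfolding matrix_vector_mult_def plane_rotation_def by (simp add: two one)
qed

lemma plane_rotation_unitary:
  assumes jk: "j \<noteq> k" and cs: "c\<^sup>2 + s\<^sup>2 = 1"
  shows "unitary_matrix (plane_rotation j k c s)"
proof -
  have adj: "map_matrix cnj (transpose (plane_rotation j k c s)) = plane_rotation j k c (- s)"
    using jk by (auto simp: plane_rotation_def transpose_def vec_eq_iff)
  have *: "plane_rotation j k c s ** plane_rotation j k c (- s) = mat 1"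
    if "c\<^sup>2 + s\<^sup>2 = 1" for c s
  proof -
    have cs': "complex_of_real c * of_real c + of_real s * of_real s = 1"
      using that by (metis of_real_add of_real_mult of_real_1 power2_eq_square)
    have "plane_rotation j k c s *v (plane_rotation j k c (- s) *v z) = z" for z
    proof -
      have e: "of_real c * (of_real c * x) + of_real s * (of_real s * x) = x" for x :: complex
        using arg_cong[OF cs', of "\<lambda>u. u * x"] by (simp add: algebra_simps)
      then show ?thesis
        using jk by (simp add: vec_eq_iff plane_rotation_vector algebra_simps e)
    qed
    then show ?thesis by (simp add: matrix_eq matrix_vector_mul_assoc[symmetric])
  qed
  show ?thesis
    unfolding unitary_matrix_def adj using *[of c s] *[of c "- s"] cs by simp
qed

context rotation_invariant_measure
begin

text \<open>
  If \<open>\<alpha>\<close> and \<open>\<beta>\<close> differ at \<open>j\<close>, rotating the \<open>j\<close>-th coordinate by the angle \<open>\<pi> / (\<alpha>\<^sub>j - \<beta>\<^sub>j)\<close>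
  changes the sign of the integrand but not the integral.
\<close>

lemma monomial_orthogonal:
  "(\<integral>z. monomial \<alpha> z * cnj (monomial \<beta> z) \<partial>M) = (if \<alpha> = \<beta> then of_real (monomial_norm2 \<alpha>) else 0)"
proof (cases "\<alpha> = \<beta>")
  case True
  have "(\<integral>z. monomial \<alpha> z * cnj (monomial \<alpha> z) \<partial>M) = (\<integral>z. of_real ((cmod (monomial \<alpha> z))\<^sup>2) \<partial>M)"
    by (simp only: complex_norm_square)
  then show ?thesis
    using True by (simp only: monomial_norm2_def integral_complex_of_real simp_thms if_True)
next
  case False
  then obtain j where j: "\<alpha> j \<noteq> \<beta> j" by auto
  let ?I = "\<integral>z. monomial \<alpha> z * cnj (monomial \<beta> z) \<partial>M"
  define w where "w = cis (pi / (real (\<alpha> j) - real (\<beta> j)))"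
  have "w ^ \<alpha> j * cnj w ^ \<beta> j = cis (real (\<alpha> j) * (pi / (real (\<alpha> j) - real (\<beta> j)))
      - real (\<beta> j) * (pi / (real (\<alpha> j) - real (\<beta> j))))"
    unfolding w_def by (simp add: Complex.DeMoivre cis_cnj cis_mult)
  also have "real (\<alpha> j) * (pi / (real (\<alpha> j) - real (\<beta> j)))
      - real (\<beta> j) * (pi / (real (\<alpha> j) - real (\<beta> j))) = pi"
    using j by (simp only: left_diff_distrib[symmetric]) simp
  finally have w: "w ^ \<alpha> j * cnj w ^ \<beta> j = - 1" by simp
  have "?I = (\<integral>z. monomial \<alpha> (coordinate_phase j w *v z) * cnj (monomial \<beta> (coordinate_phase j w *v z)) \<partial>M)"
    by (rule integral_unitary[symmetric])
      (auto intro!: coordinate_phase_unitary poly_growth_measurable poly_growth_intros simp: w_def)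
  also have "\<dots> = (\<integral>z. (w ^ \<alpha> j * cnj w ^ \<beta> j) * (monomial \<alpha> z * cnj (monomial \<beta> z)) \<partial>M)"
    by (intro Bochner_Integration.integral_cong) (auto simp: monomial_coordinate_phase)
  also have "\<dots> = - ?I" by (simp add: w)
  finally show ?thesis using False by simp
qed

text \<open>
  A polynomial in a real parameter that vanishes identically has zero coefficients; applied to
  the integral, this replaces differentiation under the integral sign.
\<close>

lemma integral_polynomial_parameter_coeff:
  assumes P: "coeffs_poly_growth P" and deg: "\<And>z. degree (P z) \<le> N"
    and zero: "\<And>t::real. (\<integral>z. poly (P z) (of_real t) \<partial>M) = 0"
  shows "(\<integral>z. coeff (P z) i \<partial>M) = 0"
proof -
  have int: "integrable M (\<lambda>z. coeff (P z) i)" for i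
    using P by (intro poly_growth_integrable) (simp add: coeffs_poly_growth_def)
  have eval: "poly (P z) x = (\<Sum>i\<le>N. coeff (P z) i * x ^ i)" for z x
    unfolding poly_altdef using deg[of z]
    by (intro sum.mono_neutral_left) (auto simp: coeff_eq_0)
  (* The polynomial whose coefficients are the integrals of the coefficients; it vanishes on the
     real line. *)
  define q where "q = (\<Sum>i\<le>N. monom (\<integral>z. coeff (P z) i \<partial>M) i)"
  have "poly q (of_real t) = 0" for t :: real
  proof -
    have "poly q (of_real t) = (\<Sum>i\<le>N. (\<integral>z. coeff (P z) i * of_real t ^ i \<partial>M))"
      by (simp add: q_def poly_sum poly_monom)
    also have "\<dots> = (\<integral>z. (\<Sum>i\<le>N. coeff (P z) i * of_real t ^ i) \<partial>M)"
      using int by simp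
    also have "\<dots> = (\<integral>z. poly (P z) (of_real t) \<partial>M)"
      by (simp add: eval)
    finally show ?thesis using zero by simp
  qed
  then have "range complex_of_real \<subseteq> {x. poly q x = 0}" by auto
  moreover have "infinite (range complex_of_real)"
    using finite_imageD[of complex_of_real UNIV] infinite_UNIV_char_0 by (auto simp: inj_on_def)
  ultimately have "q = 0"
    using poly_roots_finite[of q] infinite_super by blast
  show ?thesis
  proof (cases "i \<le> N")
    case True
    have "coeff q i = (\<integral>z. coeff (P z) i \<partial>M)"
      using True by (simp add: q_def coeff_sum)
    with \<open>q = 0\<close> show ?thesis by simp
  next
    case False
    then have "coeff (P z) i = 0" for z
      using deg[of z] by (intro coeff_eq_0) linarith
    then show ?thesis by simp
  qed
qed

text \<open>
  The monomials \<open>z\<^sup>\<alpha>\<^sup>+\<^sup>e\<^sup>j\<close> and \<open>z\<^sup>\<alpha>\<^sup>+\<^sup>e\<^sup>k\<close> stay orthogonal when both are rotated in the plane of the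
  coordinates \<open>j\<close> and \<open>k\<close>. The derivative of their inner product at angle 0 is therefore 0. The
  rotation generator sends \<open>z\<^sup>\<alpha>\<^sup>+\<^sup>e\<^sup>j\<close> to \<open>(\<alpha>\<^sub>j + 1) z\<^sup>\<alpha>\<^sup>+\<^sup>e\<^sup>k\<close> and \<open>z\<^sup>\<alpha>\<^sup>+\<^sup>e\<^sup>k\<close> to
  \<open>-(\<alpha>\<^sub>k + 1) z\<^sup>\<alpha>\<^sup>+\<^sup>e\<^sup>j\<close>, up to monomials that are orthogonal to the other factor. With the tangent
  \<open>t\<close> of the angle as parameter the rotated integrand is, up to a power of the cosine, a
  polynomial in \<open>t\<close>, and the derivative is its linear coefficient.
\<close>

lemma monomial_norm2_exchange:
  assumes jk: "j \<noteq> k"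
  shows "(\<alpha> j + 1) * monomial_norm2 (raise k \<alpha>) = (\<alpha> k + 1) * monomial_norm2 (raise j \<alpha>)"
proof -
  define a b where "a = \<alpha> j" and "b = \<alpha> k"
  define rest where "rest z = (\<Prod>i\<in>UNIV - {j, k}. (z $ i) ^ \<alpha> i)" for z :: "complex ^ 'n"
  have mono: "monomial (\<alpha>(j := p, k := q)) z = (z $ j) ^ p * (z $ k) ^ q * rest z" for p q z
  proof -
    have "monomial (\<alpha>(j := p, k := q)) z
        = (z $ j) ^ p * ((z $ k) ^ q * (\<Prod>i\<in>UNIV - {j} - {k}. (z $ i) ^ ((\<alpha>(j := p, k := q)) i)))"
      unfolding monomial_def using jk
      by (subst prod.remove[of _ j], simp, simp, subst prod.remove[of _ k]) auto
    also have "(\<Prod>i\<in>UNIV - {j} - {k}. (z $ i) ^ ((\<alpha>(j := p, k := q)) i)) = rest z"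
      unfolding rest_def by (intro prod.cong) auto
    finally show ?thesis by (simp only: mult.assoc)
  qed
  have raise_j: "raise j \<alpha> = \<alpha>(j := Suc a, k := b)" and raise_k: "raise k \<alpha> = \<alpha>(j := a, k := Suc b)"
    using jk by (auto simp: raise_def a_def b_def)
  have neq: "\<alpha>(j := p, k := q) \<noteq> \<alpha>(j := p', k := q')" if "p \<noteq> p'" for p q p' q'
    using that jk by (auto simp: fun_eq_iff split: if_splits)
  define P where "P z = [:z $ j, z $ k:] ^ Suc a * [:z $ k, - z $ j:] ^ b
      * ([:cnj (z $ j), cnj (z $ k):] ^ a * [:cnj (z $ k), - cnj (z $ j):] ^ Suc b)
      * [:rest z * cnj (rest z):]" for z
  have rest: "poly_growth rest"
    unfolding rest_def[abs_def] by (intro poly_growth_intros)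
  have neg: "poly_growth (\<lambda>z::complex^'n. - f z)" if "poly_growth f" for f
    using poly_growth_mult[OF poly_growth_const[of "-1"] that] by simp
  have "coeffs_poly_growth P"
    unfolding P_def[abs_def]
    by (intro coeffs_poly_growth_mult coeffs_poly_growth_power coeffs_poly_growth_pCons
        coeffs_poly_growth_0 poly_growth_intros neg rest)
  moreover have "degree (P z) \<le> Suc a + b + (a + Suc b) + 0" for z
  proof -
    have *: "degree ([:x, y:] ^ n) \<le> n" for x y :: complex and n
      using degree_power_le[of "[:x, y:]" n] degree_pCons_le[of x "[:y:]"]
      by (smt (verit, best) degree_pCons_le degree_0 mult_le_mono1 mult_1 order_trans One_nat_def degree_pCons_0)
    show ?thesis unfolding P_def
      by (intro degree_mult_le[THEN order_trans] add_mono *) simp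
  qed
  moreover have "(\<integral>z. poly (P z) (of_real t) \<partial>M) = 0" for t :: real
  proof -
    (* c is the cosine of the angle with tangent t; factoring it out of both rotated coordinates
       leaves a polynomial in t. *)
    define c where "c = 1 / sqrt (1 + t\<^sup>2)"
    have "1 + t\<^sup>2 > 0" by (simp add: add_pos_nonneg)
    then have c0: "c \<noteq> 0" and "c\<^sup>2 * (1 + t\<^sup>2) = 1" by (auto simp: c_def power_divide)
    then have "c\<^sup>2 + (t * c)\<^sup>2 = 1" by (simp add: power_mult_distrib algebra_simps)
    then have U: "unitary_matrix (plane_rotation j k c (t * c))"
      by (rule plane_rotation_unitary[OF jk])
    let ?R = "\<lambda>z. plane_rotation j k c (t * c) *v z"
    have Rj: "?R z $ j = of_real c * (z $ j + of_real t * z $ k)"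
      and Rk: "?R z $ k = of_real c * (z $ k + of_real t * (- z $ j))" for z
      using jk by (simp_all add: plane_rotation_vector algebra_simps)
    have Rrest: "rest (?R z) = rest z" for z
      unfolding rest_def by (intro prod.cong) (auto simp: plane_rotation_vector[OF jk])
    have *: "monomial (raise j \<alpha>) (?R z) * cnj (monomial (raise k \<alpha>) (?R z))
        = of_real (c ^ (2 * (a + b + 1))) * poly (P z) (of_real t)" for z
    proof -
      have "(C * x) ^ Suc a * (C * y) ^ b * r * cnj ((C * x) ^ a * (C * y) ^ Suc b * r)
          = C ^ (2 * (a + b + 1)) * (x ^ Suc a * y ^ b * (cnj x ^ a * cnj y ^ Suc b) * (r * cnj r))"
        if "cnj C = C" for C x y r :: complex
      proof -
        have "2 * (a + b + 1) = Suc (Suc ((a + a) + (b + b)))" by simp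
        then have "C ^ (2 * (a + b + 1)) = C * (C * ((C ^ a * C ^ a) * (C ^ b * C ^ b)))"
          by (simp only: power_Suc power_add)
        then show ?thesis
          using that by (simp only: complex_cnj_mult complex_cnj_power power_mult_distrib power_Suc mult_ac)
      qed
      note identity = this
      define x y where "x = z $ j + of_real t * z $ k" and "y = z $ k + of_real t * (- z $ j)"
      have "poly (P z) (of_real t) = x ^ Suc a * y ^ b * (cnj x ^ a * cnj y ^ Suc b) * (rest z * cnj (rest z))"
        unfolding P_def poly_mult poly_power by (simp add: x_def y_def del: power_Suc)
      then show ?thesis
        unfolding raise_j raise_k mono Rj Rk Rrest x_def[symmetric] y_def[symmetric]
        using identity[of "of_real c" x y "rest z"] by (simp only: of_real_power complex_cnj_complex_of_real)
    qed
    have "0 = (\<integral>z. monomial (raise j \<alpha>) z * cnj (monomial (raise k \<alpha>) z) \<partial>M)"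
      unfolding raise_j raise_k by (simp add: monomial_orthogonal neq)
    also have "\<dots> = (\<integral>z. monomial (raise j \<alpha>) (?R z) * cnj (monomial (raise k \<alpha>) (?R z)) \<partial>M)"
      by (rule integral_unitary[OF U, symmetric]) (intro poly_growth_measurable poly_growth_intros)
    also have "\<dots> = of_real (c ^ (2 * (a + b + 1))) * (\<integral>z. poly (P z) (of_real t) \<partial>M)"
      unfolding * by simp
    finally show ?thesis using c0 by simp
  qed
  ultimately have zero: "(\<integral>z. coeff (P z) 1 \<partial>M) = 0"
    by (rule integral_polynomial_parameter_coeff)
  let ?m = "\<lambda>p q z. monomial (\<alpha>(j := p, k := q)) z"
  have "coeff (P z) 1 = of_nat (Suc a) * (?m a (Suc b) z * cnj (?m a (Suc b) z))
      - of_nat b * (?m (Suc (Suc a)) (b - 1) z * cnj (?m a (Suc b) z))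
      + of_nat a * (?m (Suc a) b z * cnj (?m (a - 1) (Suc (Suc b)) z))
      - of_nat (Suc b) * (?m (Suc a) b z * cnj (?m (Suc a) b z))" for z
    unfolding P_def mono coeff_mult_1 coeff_power_1 coeff_mult_0 coeff_0_power
    by (simp add: algebra_simps)
  moreover have int: "integrable M (\<lambda>z. of_nat n * (?m p q z * cnj (?m p' q' z)))" for n p q p' q'
    by (intro poly_growth_integrable poly_growth_intros)
  moreover have "Suc a \<noteq> a - Suc 0" by simp
  ultimately have "of_nat (Suc a) * of_real (monomial_norm2 (raise k \<alpha>))
      - of_nat (Suc b) * of_real (monomial_norm2 (raise j \<alpha>)) = (0::complex)"
    using zero by (simp add: neq monomial_orthogonal raise_j raise_k del: of_nat_Suc)
  then have "complex_of_real (real (Suc a) * monomial_norm2 (raise k \<alpha>)) 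
     = complex_of_real (real (Suc b) * monomial_norm2 (raise j \<alpha>))"
    by simp
  then have "real (Suc a) * monomial_norm2 (raise k \<alpha>) = real (Suc b) * monomial_norm2 (raise j \<alpha>)"
    by (simp only: of_real_eq_iff)
  then show ?thesis by (simp add: a_def b_def add.commute)
qed

text \<open>
  The exchange relation says that \<open>\<parallel>z\<^sup>\<alpha>\<parallel>\<^sup>2 / \<alpha>!\<close> does not change when one unit of the exponent moves from
  one coordinate to another; moving all of it to a single coordinate reaches a normal form.
\<close>

lemma monomial_norm2_mfact_eq:
  assumes "total_degree \<alpha> = total_degree \<beta>"
  shows "monomial_norm2 \<alpha> / mfact \<alpha> = monomial_norm2 \<beta> / mfact \<beta>"
proof -
  fix j0 :: 'n
  have shift: "monomial_norm2 (raise k \<gamma>) / mfact (raise k \<gamma>) = monomial_norm2 (raise j \<gamma>) / mfact (raise j \<gamma>)"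
    for j k \<gamma>
  proof (cases "j = k")
    case False
    have "(real (\<gamma> j) + 1) * monomial_norm2 (raise k \<gamma>) = (real (\<gamma> k) + 1) * monomial_norm2 (raise j \<gamma>)"
      using monomial_norm2_exchange[OF False] by (simp add: add.commute)
    then show ?thesis
      using mfact_pos[of \<gamma>] by (simp add: mfact_raise frac_eq_eq mult.commute mult.left_commute)
  qed simp
  (* Induction on the part of the degree that is not yet at the coordinate j0. *)
  have concentrate: "monomial_norm2 \<gamma> / mfact \<gamma> = monomial_norm2 \<delta> / mfact \<delta>"
    if "\<delta> = (\<lambda>i. if i = j0 then total_degree \<gamma> else 0)" for \<gamma> \<delta>
    using that
  proof (induction "total_degree \<gamma> - \<gamma> j0" arbitrary: \<gamma>)
    case 0
    have "total_degree \<gamma> = \<gamma> j0 + (\<Sum>i\<in>UNIV - {j0}. \<gamma> i)"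
      unfolding total_degree_def by (subst sum.remove[of _ j0]) auto
    then have "\<gamma> i = (if i = j0 then total_degree \<gamma> else 0)" for i
      using 0 by auto
    then have "\<gamma> = \<delta>" using 0 by auto
    then show ?case by simp
  next
    case (Suc d)
    have "total_degree \<gamma> = \<gamma> j0 + (\<Sum>i\<in>UNIV - {j0}. \<gamma> i)"
      unfolding total_degree_def by (subst sum.remove[of _ j0]) auto
    then have "(\<Sum>i\<in>UNIV - {j0}. \<gamma> i) \<noteq> 0" using Suc.hyps by linarith
    then obtain k where k: "k \<noteq> j0" "\<gamma> k \<noteq> 0" by auto
    let ?g = "raise j0 (lower k \<gamma>)"
    have td: "total_degree ?g = total_degree \<gamma>"
      using raise_lower[of \<gamma> k] k(2) by (metis total_degree_raise)
    have "?g j0 = Suc (\<gamma> j0)" using k(1) by (simp add: raise_def lower_def)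
    then have "monomial_norm2 ?g / mfact ?g = monomial_norm2 \<delta> / mfact \<delta>"
      using Suc.hyps Suc.prems td by (intro Suc.hyps(1)) auto
    then show ?case
      using shift[of k "lower k \<gamma>" j0] raise_lower[of \<gamma> k] k(2) by simp
  qed
  show ?thesis
    using concentrate[OF refl, of \<alpha>] concentrate[OF refl, of \<beta>] by (simp only: assms)
qed

definition mom :: "nat \<Rightarrow> real" where
  "mom d = enn2real (moment M d)"

lemma mom_eq_integral: "mom d = (\<integral>z. norm z ^ (2 * d) \<partial>M)"
  unfolding mom_def moment_def
  by (subst integral_eq_nn_integral) (auto simp: borel_measurable_M)

lemma mom_pos: "0 < mom d"
  using moment_pos[of d] moment_finite[of d] by (simp add: mom_def enn2real_positive_iff)

text \<open>
  The common value \<open>A\<^sub>d\<close> of \<open>\<parallel>z\<^sup>\<alpha>\<parallel>\<^sup>2 / \<alpha>!\<close> for the multi-indices \<open>\<alpha>\<close> of degree \<open>d\<close>,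
  expressed through the moments (lemma \<open>monomial_norm2_eq\<close>).
\<close>

definition degree_weight :: "nat \<Rightarrow> real" where
  "degree_weight d = mom d / pochhammer (of_nat CARD('n)) d"

lemma card_pochhammer_pos: "0 < pochhammer (real CARD('n)) d"
  by (intro pochhammer_pos) simp

lemma degree_weight_pos: "0 < degree_weight d"
  unfolding degree_weight_def using mom_pos card_pochhammer_pos by (intro divide_pos_pos)

text \<open>
  The common value is found from the moments by expanding powers of \<open>|z|\<^sup>2 = \<Sum>\<^sub>j |z\<^sub>j|\<^sup>2\<close> one factor at a time:
  each factor raises the degree by one and, since \<open>\<Sum>\<^sub>j (\<alpha>\<^sub>j + 1) = n + |\<alpha>|\<close>, contributes one factor of
  the rising factorial.
\<close>

lemma monomial_norm2_eq:
  "monomial_norm2 \<alpha> = mfact \<alpha> * degree_weight (total_degree \<alpha>)"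
proof -
  fix j0 :: 'n
  define A where "A d = monomial_norm2 (\<lambda>i. if i = j0 then d else 0)
      / mfact (\<lambda>i. if i = j0 then d else 0)" for d
  have A: "monomial_norm2 \<alpha> = mfact \<alpha> * A (total_degree \<alpha>)" for \<alpha>
  proof -
    have "total_degree (\<lambda>i. if i = j0 then total_degree \<alpha> else 0) = total_degree \<alpha>"
      by (simp add: total_degree_def)
    then show ?thesis
      using monomial_norm2_mfact_eq[of \<alpha> "\<lambda>i. if i = j0 then total_degree \<alpha> else 0"] mfact_pos[of \<alpha>]
      unfolding A_def by (simp add: field_simps)
  qed
  have int: "integrable M (\<lambda>z. norm z ^ (2 * k) * (cmod (monomial \<alpha> z))\<^sup>2)" for k \<alpha>
  proof -
    have "poly_growth (\<lambda>z::complex^'n. of_real (norm z ^ (2 * k)) :: complex)"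
    proof -
      have "poly_growth (\<lambda>z::complex^'n. (\<Sum>i\<in>UNIV. z $ i * cnj (z $ i)) ^ k)"
        by (intro poly_growth_intros)
      moreover have "(\<Sum>i\<in>UNIV. z $ i * cnj (z $ i)) = of_real ((norm z)\<^sup>2)" for z :: "complex^'n"
        by (simp add: norm_vec_def L2_set_def sum_nonneg flip: complex_norm_square)
      ultimately show ?thesis by (simp add: power_mult)
    qed
    then have "integrable M (\<lambda>z. cmod (of_real (norm z ^ (2 * k)) * (monomial \<alpha> z * cnj (monomial \<alpha> z))))"
      by (intro integrable_norm poly_growth_integrable poly_growth_mult poly_growth_intros)
    then show ?thesis by (simp add: norm_mult power2_eq_square norm_power)
  qed
  (* Weighting with an extra monomial is what makes the induction on the power of the norm work. *)
  have H: "(\<integral>z. norm z ^ (2 * k) * (cmod (monomial \<alpha> z))\<^sup>2 \<partial>M)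
      = mfact \<alpha> * A (total_degree \<alpha> + k) * pochhammer (real CARD('n) + total_degree \<alpha>) k" for k \<alpha>
  proof (induction k arbitrary: \<alpha>)
    case 0
    then show ?case using A[of \<alpha>] by (simp add: monomial_norm2_def)
  next
    case (Suc k)
    have "norm z ^ (2 * Suc k) * (cmod (monomial \<alpha> z))\<^sup>2
        = (\<Sum>j\<in>UNIV. norm z ^ (2 * k) * (cmod (monomial (raise j \<alpha>) z))\<^sup>2)" for z
    proof -
      have "(norm z)\<^sup>2 = (\<Sum>j\<in>UNIV. (cmod (z $ j))\<^sup>2)"
        by (simp add: norm_vec_def L2_set_def sum_nonneg)
      then have "norm z ^ (2 * Suc k) = norm z ^ (2 * k) * (\<Sum>j\<in>UNIV. (cmod (z $ j))\<^sup>2)"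
        by (simp add: power_add[symmetric] mult.commute power2_eq_square)
      then show ?thesis
        by (simp add: monomial_raise norm_mult power_mult_distrib sum_distrib_left sum_distrib_right mult_ac)
    qed
    then have "(\<integral>z. norm z ^ (2 * Suc k) * (cmod (monomial \<alpha> z))\<^sup>2 \<partial>M)
        = (\<Sum>j\<in>UNIV. \<integral>z. norm z ^ (2 * k) * (cmod (monomial (raise j \<alpha>) z))\<^sup>2 \<partial>M)"
      using int by simp
    also have "\<dots> = (\<Sum>j\<in>UNIV. (real (\<alpha> j) + 1) * (mfact \<alpha> * A (total_degree \<alpha> + Suc k)
        * pochhammer (real CARD('n) + total_degree \<alpha> + 1) k))"
      unfolding Suc.IH mfact_raise total_degree_raise
      by (intro sum.cong refl) (simp add: algebra_simps)
    also have "\<dots> = (\<Sum>j\<in>UNIV. real (\<alpha> j) + 1) * (mfact \<alpha> * A (total_degree \<alpha> + Suc k)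
        * pochhammer (real CARD('n) + total_degree \<alpha> + 1) k)"
      by (simp add: sum_distrib_right)
    also have "(\<Sum>j\<in>UNIV. real (\<alpha> j) + 1) = real CARD('n) + total_degree \<alpha>"
      by (simp add: sum.distrib total_degree_def)
    finally show ?case by (simp add: pochhammer_rec mult_ac)
  qed
  have "mom d = A d * pochhammer (real CARD('n)) d" for d
    using H[of d "\<lambda>i. 0"] by (simp add: mom_eq_integral monomial_0 mfact_def total_degree_def)
  then have "A d = degree_weight d" for d
    using card_pochhammer_pos[of d] by (simp add: degree_weight_def)
  with A show ?thesis by simp
qed

lemma monomial_norm2_pos: "0 < monomial_norm2 \<alpha>"
  by (simp add: monomial_norm2_eq mfact_pos degree_weight_pos)

lemma mom_ratio: "mom (Suc d) / mom d = (real CARD('n) + d) * degree_weight (Suc d) / degree_weight d"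
proof -
  have "real CARD('n) + d \<noteq> 0" by (simp add: add_pos_nonneg less_imp_neq[symmetric])
  then show ?thesis
    using card_pochhammer_pos[of d] mom_pos[of d]
    by (simp add: degree_weight_def pochhammer_Suc divide_simps)
qed

end

section \<open>Canonical solutions for monomial forms\<close>

context rotation_invariant_measure
begin

definition conj_mult :: "('n \<Rightarrow> nat) \<Rightarrow> 'n \<Rightarrow> complex ^ 'n \<Rightarrow> complex" where
  "conj_mult \<alpha> j z = cnj (z $ j) * monomial \<alpha> z"

text \<open>
  By \<open>inner_conj_mult_monomial\<close> the function \<open>z\<^sup>*\<^sub>j z\<^sup>\<alpha>\<close> is orthogonal to every monomial except
  \<open>z\<^sup>\<alpha>\<^sup>-\<^sup>e\<^sup>j\<close>, so its orthogonal projection to the closure of the polynomials is a multiple of that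
  monomial, or 0 if \<open>\<alpha>\<^sub>j = 0\<close>.
\<close>

definition sol :: "('n \<Rightarrow> nat) \<Rightarrow> 'n \<Rightarrow> complex ^ 'n \<Rightarrow> complex" where
  "sol \<alpha> j z = conj_mult \<alpha> j z
     - (if \<alpha> j = 0 then 0 else of_real (monomial_norm2 \<alpha> / monomial_norm2 (lower j \<alpha>))) * monomial (lower j \<alpha>) z"

lemma poly_growth_conj_mult: "poly_growth (conj_mult \<alpha> j)"
  unfolding conj_mult_def[abs_def] by (intro poly_growth_intros)

lemma poly_growth_sol: "poly_growth (sol \<alpha> j)"
  unfolding sol_def[abs_def] by (intro poly_growth_intros poly_growth_conj_mult)

lemma conj_mult_L2: "conj_mult \<alpha> j \<in> L2 M"
  by (intro poly_growth_L2 poly_growth_conj_mult)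

lemma sol_L2: "sol \<alpha> j \<in> L2 M"
  by (intro poly_growth_L2 poly_growth_sol)

lemma inner_monomial:
  "L2_inner M (monomial \<alpha>) (monomial \<beta>) = (if \<alpha> = \<beta> then of_real (monomial_norm2 \<alpha>) else 0)"
  unfolding L2_inner_def by (rule monomial_orthogonal)

lemma inner_conj_mult_monomial:
  "L2_inner M (conj_mult \<alpha> j) (monomial \<beta>) = (if \<alpha> = raise j \<beta> then of_real (monomial_norm2 \<alpha>) else 0)"
proof -
  have "L2_inner M (conj_mult \<alpha> j) (monomial \<beta>) = L2_inner M (monomial \<alpha>) (monomial (raise j \<beta>))"
    unfolding L2_inner_def by (intro Bochner_Integration.integral_cong) (auto simp: conj_mult_def monomial_raise)
  then show ?thesis by (simp add: inner_monomial)
qed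

lemma inner_conj_mult:
  "L2_inner M (conj_mult \<alpha> j) (conj_mult \<beta> k)
    = (if raise k \<alpha> = raise j \<beta> then of_real (monomial_norm2 (raise k \<alpha>)) else 0)"
proof -
  have "L2_inner M (conj_mult \<alpha> j) (conj_mult \<beta> k) = L2_inner M (monomial (raise k \<alpha>)) (monomial (raise j \<beta>))"
    unfolding L2_inner_def by (intro Bochner_Integration.integral_cong) (auto simp: conj_mult_def monomial_raise)
  then show ?thesis by (simp add: inner_monomial)
qed

lemma sol_orthogonal_monomial: "L2_inner M (sol \<alpha> j) (monomial \<beta>) = 0"
proof -
  have "L2_inner M (sol \<alpha> j) (monomial \<beta>) = L2_inner M (conj_mult \<alpha> j) (monomial \<beta>)
      - (if \<alpha> j = 0 then 0 else of_real (monomial_norm2 \<alpha> / monomial_norm2 (lower j \<alpha>)))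
        * L2_inner M (monomial (lower j \<alpha>)) (monomial \<beta>)"
    unfolding sol_def[abs_def]
    by (simp add: L2_inner_diff_left L2_inner_scale_left L2_scale conj_mult_L2 monomial_L2 del: of_real_divide)
  moreover have "\<alpha> = raise j \<beta> \<longleftrightarrow> \<alpha> j \<noteq> 0 \<and> lower j \<alpha> = \<beta>"
    by (auto simp: raise_lower) (simp add: raise_def)
  moreover have "monomial_norm2 (lower j \<alpha>) \<noteq> 0"
    using monomial_norm2_pos[of "lower j \<alpha>"] by simp
  ultimately show ?thesis
    by (auto simp: inner_conj_mult_monomial inner_monomial)
qed

lemma gram_sol:
  "L2_inner M (sol \<alpha> j) (sol \<beta> k) = L2_inner M (conj_mult \<alpha> j) (conj_mult \<beta> k)
    - (if \<beta> k \<noteq> 0 \<and> \<alpha> = raise j (lower k \<beta>)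
       then of_real (monomial_norm2 \<beta> / monomial_norm2 (lower k \<beta>) * monomial_norm2 \<alpha>) else 0)"
proof -
  define a where "a = (if \<alpha> j = 0 then 0 else complex_of_real (monomial_norm2 \<alpha> / monomial_norm2 (lower j \<alpha>)))"
  define b where "b = (if \<beta> k = 0 then 0 else complex_of_real (monomial_norm2 \<beta> / monomial_norm2 (lower k \<beta>)))"
  have "L2_inner M (monomial (lower j \<alpha>)) (sol \<beta> k) = 0"
    by (metis L2_inner_cnj sol_orthogonal_monomial complex_cnj_zero)
  then have "L2_inner M (sol \<alpha> j) (sol \<beta> k) = L2_inner M (conj_mult \<alpha> j) (sol \<beta> k)"
    unfolding sol_def[of \<alpha> j, abs_def] a_def[symmetric]
    by (simp add: L2_inner_diff_left L2_inner_scale_left L2_scale conj_mult_L2 monomial_L2 sol_L2)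
  also have "\<dots> = L2_inner M (conj_mult \<alpha> j) (conj_mult \<beta> k)
      - cnj b * L2_inner M (conj_mult \<alpha> j) (monomial (lower k \<beta>))"
    unfolding sol_def[of \<beta> k, abs_def] b_def[symmetric]
    by (simp add: L2_inner_diff_right L2_inner_scale_right L2_scale conj_mult_L2 monomial_L2)
  finally show ?thesis
    by (auto simp: inner_conj_mult_monomial b_def)
qed

text \<open>
  The condition \<open>\<alpha> + e\<^sub>k = \<beta> + e\<^sub>j\<close> expresses equality of the torus weights \<open>\<alpha> - e\<^sub>j\<close> and \<open>\<beta> - e\<^sub>k\<close>
  without leaving the natural numbers.
\<close>

lemma gram_sol_eq_0:
  assumes "raise k \<alpha> \<noteq> raise j \<beta>"
  shows "L2_inner M (sol \<alpha> j) (sol \<beta> k) = 0"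
proof -
  have "\<not> (\<beta> k \<noteq> 0 \<and> \<alpha> = raise j (lower k \<beta>))"
    using assms by (auto simp: raise_commute[of k j] raise_lower)
  then show ?thesis using assms by (simp only: gram_sol inner_conj_mult if_False) simp
qed

lemma sol_norm_vanishing_exponent:
  assumes "\<alpha> j = 0"
  shows "(L2_norm M (sol \<alpha> j))\<^sup>2 = mfact \<alpha> * degree_weight (Suc (total_degree \<alpha>))"
proof -
  have "complex_of_real ((L2_norm M (sol \<alpha> j))\<^sup>2) = of_real (monomial_norm2 (raise j \<alpha>))"
    unfolding L2_inner_self[symmetric] gram_sol inner_conj_mult using assms by simp
  then have "(L2_norm M (sol \<alpha> j))\<^sup>2 = monomial_norm2 (raise j \<alpha>)"
    by (simp only: of_real_eq_iff)
  then show ?thesis using assms by (simp add: monomial_norm2_eq mfact_raise)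
qed

text \<open>
  In the block of weight \<open>\<delta>\<close> the Gram matrix is a diagonal matrix plus a matrix of rank one. The diagonal
  comes from \<open>(\<delta> + e\<^sub>j + e\<^sub>k)!\<close>, which has the factor \<open>\<delta>\<^sub>j + 2\<close> instead of a second \<open>\<delta>\<^sub>j + 1\<close> if \<open>j = k\<close>.
\<close>

lemma gram_sol_raise:
  "L2_inner M (sol (raise j \<delta>) j) (sol (raise k \<delta>) k) = of_real (mfact \<delta> *
     ((degree_weight (Suc (Suc (total_degree \<delta>))) - (degree_weight (Suc (total_degree \<delta>)))\<^sup>2 / degree_weight (total_degree \<delta>))
        * (real (Suc (\<delta> j)) * real (Suc (\<delta> k)))
      + (if k = j then degree_weight (Suc (Suc (total_degree \<delta>))) * real (Suc (\<delta> j)) else 0)))"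
proof -
  define U0 U1 U2 where "U0 = degree_weight (total_degree \<delta>)"
    and "U1 = degree_weight (Suc (total_degree \<delta>))" and "U2 = degree_weight (Suc (Suc (total_degree \<delta>)))"
  have pos: "U0 \<noteq> 0" "mfact \<delta> \<noteq> 0"
    using degree_weight_pos[of "total_degree \<delta>"] mfact_pos[of \<delta>] by (auto simp: U0_def)
  have "raise k \<delta> k \<noteq> 0" by (simp add: raise_def)
  then have "L2_inner M (sol (raise j \<delta>) j) (sol (raise k \<delta>) k)
      = of_real (monomial_norm2 (raise k (raise j \<delta>)) - monomial_norm2 (raise k \<delta>) / monomial_norm2 \<delta> * monomial_norm2 (raise j \<delta>))"
    unfolding gram_sol inner_conj_mult by (simp add: raise_commute[of k j])
  also have "monomial_norm2 (raise k (raise j \<delta>)) = mfact \<delta> * (real (Suc (\<delta> j)) * (real (Suc (\<delta> k)) + (if k = j then 1 else 0))) * U2"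
    by (simp add: monomial_norm2_eq mfact_raise U2_def) (simp add: raise_def algebra_simps)
  also have "monomial_norm2 (raise k \<delta>) / monomial_norm2 \<delta> * monomial_norm2 (raise j \<delta>)
      = mfact \<delta> * (U1\<^sup>2 / U0 * (real (Suc (\<delta> j)) * real (Suc (\<delta> k))))"
    using pos by (simp add: monomial_norm2_eq mfact_raise flip: U0_def U1_def) (simp add: power2_eq_square field_simps)
  finally show ?thesis
    unfolding U0_def[symmetric] U1_def[symmetric] U2_def[symmetric]
    by (simp add: algebra_simps)
qed

lemma sol_block_norm:
  fixes u :: "'n \<Rightarrow> complex"
  shows "(L2_norm M (\<lambda>z. \<Sum>j\<in>J. u j * sol (raise j \<delta>) j z))\<^sup>2 = mfact \<delta> *
     ((degree_weight (Suc (Suc (total_degree \<delta>))) - (degree_weight (Suc (total_degree \<delta>)))\<^sup>2 / degree_weight (total_degree \<delta>))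
        * (cmod (\<Sum>j\<in>J. u j * of_nat (Suc (\<delta> j))))\<^sup>2
      + degree_weight (Suc (Suc (total_degree \<delta>))) * (\<Sum>j\<in>J. (cmod (u j))\<^sup>2 * Suc (\<delta> j)))"
proof -
  define U where "U = degree_weight (Suc (Suc (total_degree \<delta>)))"
  define B where "B = U - (degree_weight (Suc (total_degree \<delta>)))\<^sup>2 / degree_weight (total_degree \<delta>)"
  have L: "(\<lambda>z. u j * sol (raise j \<delta>) j z) \<in> L2 M" for j
    by (intro L2_scale sol_L2)
  have "complex_of_real ((L2_norm M (\<lambda>z. \<Sum>j\<in>J. u j * sol (raise j \<delta>) j z))\<^sup>2)
      = (\<Sum>j\<in>J. \<Sum>k\<in>J. u j * cnj (u k) * L2_inner M (sol (raise j \<delta>) j) (sol (raise k \<delta>) k))"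
    unfolding L2_inner_self[symmetric]
    by (simp add: L2_inner_sum_left L2_inner_sum_right L L2_sum sol_L2 L2_inner_scale_left L2_inner_scale_right
        sum_distrib_left mult_ac)
  also have "\<dots> = (\<Sum>j\<in>J. \<Sum>k\<in>J. of_real (mfact \<delta>) * (of_real B * ((u j * of_nat (Suc (\<delta> j))) * cnj (u k * of_nat (Suc (\<delta> k))))
      + (if k = j then of_real U * (u j * cnj (u j) * of_nat (Suc (\<delta> j))) else 0)))"
    unfolding gram_sol_raise U_def[symmetric] B_def[symmetric]
    by (intro sum.cong refl) (auto simp: algebra_simps)
  also have "\<dots> = of_real (mfact \<delta>) * (of_real B * (\<Sum>j\<in>J. \<Sum>k\<in>J. (u j * of_nat (Suc (\<delta> j))) * cnj (u k * of_nat (Suc (\<delta> k))))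
      + of_real U * (\<Sum>j\<in>J. u j * cnj (u j) * of_nat (Suc (\<delta> j))))"
  proof -
    have "(\<Sum>j\<in>J. \<Sum>k\<in>J. c * (b * a j k + (if k = j then e * v j else 0)))
        = c * (b * (\<Sum>j\<in>J. \<Sum>k\<in>J. a j k) + e * (\<Sum>j\<in>J. v j))"
      for a :: "'n \<Rightarrow> 'n \<Rightarrow> complex" and v b c e
      by (simp only: sum_distrib_left[symmetric] sum.distrib) (simp add: sum_distrib_left)
    then show ?thesis .
  qed
  also have "(\<Sum>j\<in>J. \<Sum>k\<in>J. (u j * of_nat (Suc (\<delta> j))) * cnj (u k * of_nat (Suc (\<delta> k))))
      = of_real ((cmod (\<Sum>j\<in>J. u j * of_nat (Suc (\<delta> j))))\<^sup>2)"
    unfolding complex_norm_square cnj_sum sum_product ..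
  also have "(\<Sum>j\<in>J. u j * cnj (u j) * of_nat (Suc (\<delta> j))) = of_real (\<Sum>j\<in>J. (cmod (u j))\<^sup>2 * Suc (\<delta> j))"
    unfolding complex_norm_square[symmetric] by simp
  finally show ?thesis
    unfolding U_def[symmetric] B_def[symmetric]
    by (simp only: of_real_mult[symmetric] of_real_add[symmetric] of_real_eq_iff)
qed

section \<open>The norm on a weight space\<close>

text \<open>
  The quantity \<open>Y\<^sub>d\<close>: the value of \<open>S\<^sup>*S\<close> on the tangential forms of degree \<open>d\<close>, those orthogonal to all
  radial forms \<open>z\<^sup>\<delta> \<Sum>\<^sub>j z\<^sub>j dz\<^sup>*\<^sub>j\<close>.
\<close>

definition weight_ratio :: "nat \<Rightarrow> real" where
  "weight_ratio d = degree_weight (Suc d) / degree_weight d"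

lemma weight_ratio_pos: "0 < weight_ratio d"
  unfolding weight_ratio_def by (intro divide_pos_pos degree_weight_pos)

lemma mom_ratio_weight_ratio: "mom (Suc d) / mom d = (real CARD('n) + d) * weight_ratio d"
  by (simp add: mom_ratio weight_ratio_def)

lemma degree_weight_Suc: "degree_weight (Suc d) = weight_ratio d * degree_weight d"
  using degree_weight_pos[of d] by (simp add: weight_ratio_def)

lemma sol_block_norm_weight_ratio:
  fixes u :: "'n \<Rightarrow> complex" and \<delta> :: "'n \<Rightarrow> nat"
  defines "d \<equiv> total_degree \<delta>"
  shows "(L2_norm M (\<lambda>z. \<Sum>j\<in>J. u j * sol (raise j \<delta>) j z))\<^sup>2 = mfact \<delta> * degree_weight (Suc d) *
     ((weight_ratio (Suc d) - weight_ratio d) * (cmod (\<Sum>j\<in>J. u j * of_nat (Suc (\<delta> j))))\<^sup>2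
      + weight_ratio (Suc d) * (\<Sum>j\<in>J. (cmod (u j))\<^sup>2 * Suc (\<delta> j)))"
  unfolding sol_block_norm d_def[symmetric] degree_weight_Suc[of "Suc d"]
  using degree_weight_pos[of d] by (simp add: degree_weight_Suc[of d] power2_eq_square algebra_simps)

lemma weighted_Cauchy_Schwarz:
  fixes u :: "'i \<Rightarrow> complex" and w :: "'i \<Rightarrow> real"
  assumes w: "\<And>j. j \<in> J \<Longrightarrow> 0 \<le> w j"
  shows "(cmod (\<Sum>j\<in>J. u j * of_real (w j)))\<^sup>2 \<le> (\<Sum>j\<in>J. w j) * (\<Sum>j\<in>J. (cmod (u j))\<^sup>2 * w j)"
proof -
  have "cmod (\<Sum>j\<in>J. u j * of_real (w j)) \<le> (\<Sum>j\<in>J. cmod (u j * of_real (w j)))"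
    by (rule norm_sum)
  also have "\<dots> = (\<Sum>j\<in>J. sqrt (w j) * (cmod (u j) * sqrt (w j)))"
    using w by (intro sum.cong refl) (simp add: norm_mult mult_ac)
  finally have "(cmod (\<Sum>j\<in>J. u j * of_real (w j)))\<^sup>2 \<le> (\<Sum>j\<in>J. sqrt (w j) * (cmod (u j) * sqrt (w j)))\<^sup>2"
    by (intro power_mono) auto
  also have "\<dots> \<le> (\<Sum>j\<in>J. (sqrt (w j))\<^sup>2) * (\<Sum>j\<in>J. (cmod (u j) * sqrt (w j))\<^sup>2)"
    by (rule Cauchy_Schwarz_ineq_sum)
  also have "\<dots> = (\<Sum>j\<in>J. w j) * (\<Sum>j\<in>J. (cmod (u j))\<^sup>2 * w j)"
    using w by (simp add: power_mult_distrib)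
  finally show ?thesis .
qed

text \<open>
  The quantity \<open>X\<^sub>d\<close>: the value of \<open>S\<^sup>*S\<close> on the radial forms \<open>z\<^sup>\<delta> \<Sum>\<^sub>j z\<^sub>j dz\<^sup>*\<^sub>j\<close> with \<open>|\<delta>| = d\<close>.
\<close>

definition radial_value :: "nat \<Rightarrow> real" where
  "radial_value d = (real CARD('n) + d + 1) * weight_ratio (Suc d) - (real CARD('n) + d) * weight_ratio d"

lemma radial_block_norm:
  fixes \<delta> :: "'n \<Rightarrow> nat"
  defines "d \<equiv> total_degree \<delta>"
  shows "(L2_norm M (\<lambda>z. \<Sum>j\<in>UNIV. sol (raise j \<delta>) j z))\<^sup>2
    = radial_value d * (\<Sum>j\<in>UNIV. monomial_norm2 (raise j \<delta>))"
proof -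
  define W where "W = real CARD('n) + d"
  have W: "(\<Sum>j\<in>UNIV. real (Suc (\<delta> j))) = W"
    by (simp add: W_def d_def total_degree_def sum.distrib)
  have "cmod (\<Sum>j\<in>UNIV. 1 * of_nat (Suc (\<delta> j))) = cmod (of_real (\<Sum>j\<in>UNIV. real (Suc (\<delta> j))))"
    by simp
  also have "\<dots> = W" unfolding W norm_of_real by (simp add: W_def)
  finally have c: "cmod (\<Sum>j\<in>UNIV. 1 * of_nat (Suc (\<delta> j))) = W" .
  have "(L2_norm M (\<lambda>z. \<Sum>j\<in>UNIV. 1 * sol (raise j \<delta>) j z))\<^sup>2
      = mfact \<delta> * degree_weight (Suc d) * ((weight_ratio (Suc d) - weight_ratio d) * W\<^sup>2 + weight_ratio (Suc d) * W)"
    unfolding sol_block_norm_weight_ratio c d_def[symmetric] using W by simp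
  moreover have "(\<Sum>j\<in>UNIV. monomial_norm2 (raise j \<delta>)) = mfact \<delta> * degree_weight (Suc d) * W"
    unfolding W[symmetric] by (simp add: monomial_norm2_eq mfact_raise d_def sum_distrib_left mult_ac add.commute)
  ultimately show ?thesis
    by (simp add: radial_value_def W_def power2_eq_square algebra_simps)
qed

text \<open>
  As an eigenvalue of \<open>S\<^sup>*S\<close>, the radial value is a quotient of two squared norms.
\<close>

lemma radial_value_nonneg: "0 \<le> radial_value d"
proof -
  fix j0 :: 'n
  let ?d = "\<lambda>i. if i = j0 then d else 0"
  have "total_degree ?d = d" by (simp add: total_degree_def)
  moreover have "0 \<le> radial_value (total_degree ?d) * (\<Sum>j\<in>UNIV. monomial_norm2 (raise j ?d))"
    unfolding radial_block_norm[symmetric] by (rule zero_le_power2)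
  moreover have "0 < (\<Sum>j\<in>UNIV. monomial_norm2 (raise j ?d))"
    by (intro sum_pos monomial_norm2_pos) auto
  ultimately show ?thesis by (simp add: zero_le_mult_iff)
qed

text \<open>
  The squared norm of the image is an affine function of \<open>s = |\<Sum>\<^sub>j u\<^sub>j w\<^sub>j|\<^sup>2\<close>, and
  \<open>0 \<le> s \<le> (n+d) \<Sum>\<^sub>j |u\<^sub>j|\<^sup>2 w\<^sub>j\<close> by the Cauchy--Schwarz inequality. At the two ends of this interval it
  is given by the two eigenvalues, and for \<open>n \<ge> 2\<close> each of them is at most the trace. If \<open>n = 1\<close>, only
  the upper end occurs, where the value is \<open>X\<^sub>d\<close>, which then is the trace.
\<close>

lemma sol_block_bound:
  assumes K: "radial_value (total_degree \<delta>) + (real CARD('n) - 1) * weight_ratio (Suc (total_degree \<delta>)) \<le> K"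
  shows "(L2_norm M (\<lambda>z. \<Sum>j\<in>J. u j * sol (raise j \<delta>) j z))\<^sup>2
    \<le> K * (\<Sum>j\<in>J. (cmod (u j))\<^sup>2 * monomial_norm2 (raise j \<delta>))"
proof -
  define d W where "d = total_degree \<delta>" and "W = real CARD('n) + d"
  define s where "s = (cmod (\<Sum>j\<in>J. u j * of_nat (Suc (\<delta> j))))\<^sup>2"
  define t where "t = (\<Sum>j\<in>J. (cmod (u j))\<^sup>2 * Suc (\<delta> j))"
  define Y Y' where "Y = weight_ratio (Suc d)" and "Y' = weight_ratio d"
  have W: "(\<Sum>j\<in>UNIV. real (Suc (\<delta> j))) = W"
    by (simp add: W_def d_def total_degree_def sum.distrib)
  have X: "radial_value d = W * (Y - Y') + Y"
    by (simp add: radial_value_def W_def Y_def Y'_def algebra_simps)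
  have K': "W * (Y - Y') + Y + (real CARD('n) - 1) * Y \<le> K"
    using K by (simp add: X flip: d_def Y_def)
  have Y: "0 < Y" by (simp add: Y_def weight_ratio_pos)
  have t0: "0 \<le> t" by (simp add: t_def sum_nonneg)
  have s0: "0 \<le> s" by (simp add: s_def)
  have sW: "s \<le> W * t"
  proof -
    have "s \<le> (\<Sum>j\<in>J. real (Suc (\<delta> j))) * t"
      using weighted_Cauchy_Schwarz[of J "\<lambda>j. real (Suc (\<delta> j))" u] by (simp add: s_def t_def)
    also have "\<dots> \<le> W * t"
      unfolding W[symmetric] using t0 by (intro mult_right_mono sum_mono2) auto
    finally show ?thesis .
  qed
  have main: "(Y - Y') * s + Y * t \<le> K * t"
  (* The sign of Y - Y' decides at which end of the range of s the left-hand side is largest. *)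
  proof (cases "Y' \<le> Y")
    case True
    then have "(Y - Y') * s \<le> (Y - Y') * (W * t)" using sW by (intro mult_left_mono) auto
    then have "(Y - Y') * s + Y * t \<le> (W * (Y - Y') + Y) * t" by (simp add: algebra_simps)
    also have "\<dots> \<le> K * t"
    proof (rule mult_right_mono[OF _ t0])
      have "1 \<le> real CARD('n)" by (simp add: Suc_le_eq)
      then have "0 \<le> (real CARD('n) - 1) * Y" using Y by simp
      then show "W * (Y - Y') + Y \<le> K" using K' by linarith
    qed
    finally show ?thesis .
  next
    case False
    show ?thesis
    proof (cases "CARD('n) = 1")
      case True
      then obtain x :: 'n where x: "(UNIV :: 'n set) = {x}" by (rule card_1_singletonE)
      then consider "J = {}" | "J = {x}" by (metis subset_singletonD subset_UNIV)
      then have "s = W * t"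
      proof cases
        case 2
        have "real (Suc (\<delta> x)) = W" using W unfolding x by simp
        then show ?thesis
          unfolding s_def t_def 2
          by (simp add: norm_mult power_mult_distrib power2_eq_square del: of_nat_Suc)
      qed (simp add: s_def t_def)
      then have "(Y - Y') * s + Y * t = (W * (Y - Y') + Y) * t" by (simp add: algebra_simps)
      also have "\<dots> \<le> K * t" using K' True by (intro mult_right_mono t0) simp
      finally show ?thesis .
    next
      case n2: False
      have "(Y - Y') * s + Y * t \<le> Y * t" using False s0 by (simp add: mult_nonpos_nonneg)
      also have "\<dots> \<le> K * t"
      proof (rule mult_right_mono[OF _ t0])
        have "2 \<le> CARD('n)" using n2 zero_less_card_finite[where 'a='n] by linarith
        then have "1 * Y \<le> (real CARD('n) - 1) * Y" using Y by (intro mult_right_mono) auto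
        moreover have "0 \<le> W * (Y - Y') + Y" using radial_value_nonneg[of d] X by simp
        ultimately show "Y \<le> K" using K' by linarith
      qed
      finally show ?thesis .
    qed
  qed
  have "(L2_norm M (\<lambda>z. \<Sum>j\<in>J. u j * sol (raise j \<delta>) j z))\<^sup>2
      = mfact \<delta> * degree_weight (Suc d) * ((Y - Y') * s + Y * t)"
    unfolding sol_block_norm_weight_ratio s_def t_def Y_def Y'_def d_def ..
  also have "\<dots> \<le> mfact \<delta> * degree_weight (Suc d) * (K * t)"
    using main by (intro mult_left_mono mult_nonneg_nonneg less_imp_le[OF mfact_pos] less_imp_le[OF degree_weight_pos])
  also have "\<dots> = K * (\<Sum>j\<in>J. (cmod (u j))\<^sup>2 * monomial_norm2 (raise j \<delta>))"
    by (simp add: t_def monomial_norm2_eq mfact_raise d_def sum_distrib_left mult_ac add.commute)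
  finally show ?thesis .
qed

text \<open>
  The weight \<open>\<alpha> - e\<^sub>j\<close> of \<open>z\<^sup>\<alpha> dz\<^sup>*\<^sub>j\<close>; its values are integers because the entry at \<open>j\<close> may be \<open>-1\<close>.
\<close>

definition torus_weight :: "('n \<Rightarrow> nat) \<times> 'n \<Rightarrow> 'n \<Rightarrow> int" where
  "torus_weight p i = int (fst p i) - (if i = snd p then 1 else 0)"

lemma torus_weight_eq_iff:
  "torus_weight (\<alpha>, j) = torus_weight (\<beta>, k) \<longleftrightarrow> raise k \<alpha> = raise j \<beta>"
proof -
  have "torus_weight (\<alpha>, j) i = torus_weight (\<beta>, k) i \<longleftrightarrow> raise k \<alpha> i = raise j \<beta> i" for i
    by (auto simp: torus_weight_def raise_def)
  then show ?thesis by (simp add: fun_eq_iff)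
qed

text \<open>
  Grouping the terms by weight makes both sides orthogonal sums, so it suffices to bound each
  block. A block whose weight has an entry \<open>-1\<close> at \<open>j\<close> consists of the single pair \<open>(\<alpha>, j)\<close> with
  \<open>\<alpha>\<^sub>j = 0\<close>. There the bound is \<open>Y\<^sub>|\<^sub>\<alpha>\<^sub>|\<close>, which is controlled by the trace as soon as \<open>|\<alpha>| \<ge> 1\<close>,
  because then there is a second coordinate; the degree 0 accounts for the separate assumption.
\<close>

lemma sol_combination_bound:
  fixes u :: "('n \<Rightarrow> nat) \<times> 'n \<Rightarrow> complex"
  assumes fin: "finite F"
    and K: "\<And>d. radial_value d + (real CARD('n) - 1) * weight_ratio (Suc d) \<le> K"
    and K0: "weight_ratio 0 \<le> K"
  shows "(L2_norm M (\<lambda>z. \<Sum>p\<in>F. u p * sol (fst p) (snd p) z))\<^sup>2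
    \<le> K * (\<Sum>p\<in>F. (cmod (u p))\<^sup>2 * monomial_norm2 (fst p))"
proof -
  define fiber where "fiber v = {p \<in> F. torus_weight p = v}" for v
  define f where "f v z = (\<Sum>p\<in>fiber v. u p * sol (fst p) (snd p) z)" for v z
  have fin_fiber: "finite (fiber v)" for v using fin by (simp add: fiber_def)
  have fL: "f v \<in> L2 M" for v
    unfolding f_def[abs_def] by (intro L2_sum L2_scale sol_L2)
  have block: "(L2_norm M (f v))\<^sup>2 \<le> K * (\<Sum>p\<in>fiber v. (cmod (u p))\<^sup>2 * monomial_norm2 (fst p))" for v
  (* The weight v has an entry -1 iff some, and then the only, pair in its fiber has a vanishing
     exponent at its own index. *)
  proof (cases "\<exists>p\<in>fiber v. fst p (snd p) = 0")
    case True
    then obtain \<alpha> j where p: "(\<alpha>, j) \<in> fiber v" and 0: "\<alpha> j = 0" by force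
    have "q = (\<alpha>, j)" if "q \<in> fiber v" for q
    proof -
      obtain \<beta> k where q: "q = (\<beta>, k)" by force
      then have eq: "raise k \<alpha> = raise j \<beta>"
        using that p torus_weight_eq_iff by (auto simp: fiber_def)
      then have "raise k \<alpha> j = raise j \<beta> j" by simp
      then have "k = j" using 0 by (auto simp: raise_def split: if_splits)
      then show ?thesis using eq q by (simp add: raise_inject)
    qed
    then have fib: "fiber v = {(\<alpha>, j)}" using p by blast
    have "weight_ratio (total_degree \<alpha>) \<le> K"
    proof (cases "total_degree \<alpha>")
      case 0
      then show ?thesis using K0 by simp
    next
      case (Suc d)
      have "\<alpha> \<noteq> (\<lambda>_. 0)" using Suc by (auto simp: total_degree_def)
      then obtain k where "\<alpha> k \<noteq> 0" by auto
      then have "j \<noteq> k" using 0 by metis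
      then have "2 \<le> CARD('n)"
        using card_mono[OF finite subset_UNIV, of "{j, k}"] by simp
      then have "1 * weight_ratio (Suc d) \<le> (real CARD('n) - 1) * weight_ratio (Suc d)"
        using weight_ratio_pos[of "Suc d"] by (intro mult_right_mono) auto
      then show ?thesis using K[of d] radial_value_nonneg[of d] Suc by simp
    qed
    then have "(cmod (u (\<alpha>, j)))\<^sup>2 * (monomial_norm2 \<alpha> * weight_ratio (total_degree \<alpha>)) \<le> (cmod (u (\<alpha>, j)))\<^sup>2 * (monomial_norm2 \<alpha> * K)"
      using monomial_norm2_pos[of \<alpha>] by (intro mult_left_mono) auto
    moreover have "(L2_norm M (f v))\<^sup>2 = (cmod (u (\<alpha>, j)))\<^sup>2 * (monomial_norm2 \<alpha> * weight_ratio (total_degree \<alpha>))"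
      unfolding f_def fib using 0
      by (simp add: L2_norm_scale power_mult_distrib sol_norm_vanishing_exponent monomial_norm2_eq degree_weight_Suc mult_ac)
    ultimately show ?thesis by (simp add: fib mult_ac)
  next
    case nz: False
    show ?thesis
    proof (cases "fiber v = {}")
      case True
      then show ?thesis by (simp add: f_def[abs_def] L2_norm_zero)
    next
      case False
      then obtain \<alpha> j where p: "(\<alpha>, j) \<in> fiber v" by force
      then have aj: "\<alpha> j \<noteq> 0" using nz by force
      define \<delta> where "\<delta> = lower j \<alpha>"
      have \<alpha>: "\<alpha> = raise j \<delta>" using aj by (simp add: \<delta>_def raise_lower)
      have el: "q = (raise (snd q) \<delta>, snd q)" if "q \<in> fiber v" for q
      proof -
        obtain \<beta> k where q: "q = (\<beta>, k)" by force
        then have "raise k \<alpha> = raise j \<beta>"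
          using that p torus_weight_eq_iff by (auto simp: fiber_def)
        then show ?thesis using q by (simp add: \<alpha> raise_commute[of k j] raise_inject)
      qed
      define J where "J = snd ` fiber v"
      have fib: "fiber v = (\<lambda>j. (raise j \<delta>, j)) ` J"
        unfolding J_def image_image using el by force
      have inj: "inj_on (\<lambda>j. (raise j \<delta>, j)) J" by (auto simp: inj_on_def)
      have "f v = (\<lambda>z. \<Sum>j\<in>J. u (raise j \<delta>, j) * sol (raise j \<delta>) j z)"
        unfolding f_def[abs_def] fib sum.reindex[OF inj] by (simp add: o_def)
      then show ?thesis
        using sol_block_bound[OF K, where J = J and u = "\<lambda>j. u (raise j \<delta>, j)"]
        unfolding fib sum.reindex[OF inj] by (simp add: o_def)
    qed
  qed
  have group: "(\<Sum>v\<in>torus_weight ` F. \<Sum>p\<in>fiber v. g p) = (\<Sum>p\<in>F. g p)" for g :: "_ \<Rightarrow> 'c::comm_monoid_add"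
    unfolding fiber_def using fin by (intro sum.group) auto
  have "(L2_norm M (\<lambda>z. \<Sum>p\<in>F. u p * sol (fst p) (snd p) z))\<^sup>2
      = (L2_norm M (\<lambda>z. \<Sum>v\<in>torus_weight ` F. f v z))\<^sup>2"
    unfolding f_def group ..
  also have "\<dots> = (\<Sum>v\<in>torus_weight ` F. (L2_norm M (f v))\<^sup>2)"
  proof (rule L2_Pythagoras)
    fix v v' :: "'n \<Rightarrow> int" assume "v \<noteq> v'"
    have "L2_inner M (sol (fst p) (snd p)) (sol (fst q) (snd q)) = 0" if "p \<in> fiber v" "q \<in> fiber v'" for p q
      using that \<open>v \<noteq> v'\<close> torus_weight_eq_iff[of "fst p" "snd p" "fst q" "snd q"]
      by (intro gram_sol_eq_0) (auto simp: fiber_def)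
    then show "L2_inner M (f v) (f v') = 0"
      unfolding f_def[abs_def]
      by (simp add: L2_inner_sum_left L2_inner_sum_right L2_sum L2_scale sol_L2 L2_inner_scale_left L2_inner_scale_right)
  qed (use fin fL in auto)
  also have "\<dots> \<le> (\<Sum>v\<in>torus_weight ` F. K * (\<Sum>p\<in>fiber v. (cmod (u p))\<^sup>2 * monomial_norm2 (fst p)))"
    by (intro sum_mono block)
  also have "\<dots> = K * (\<Sum>p\<in>F. (cmod (u p))\<^sup>2 * monomial_norm2 (fst p))"
    unfolding sum_distrib_left[symmetric] group ..
  finally show ?thesis .
qed

end

section \<open>Polynomials and their closure\<close>

lemma polynomialsI: "finite A \<Longrightarrow> (\<lambda>z. \<Sum>\<alpha>\<in>A. c \<alpha> * monomial \<alpha> z) \<in> polynomials"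
  unfolding polynomials_def by blast

lemma polynomials_linear_combination:
  assumes "p \<in> polynomials" "q \<in> polynomials"
  shows "(\<lambda>z. a * p z + b * q z) \<in> polynomials"
proof -
  obtain A c where A: "finite A" and p: "p = (\<lambda>z. \<Sum>\<alpha>\<in>A. c \<alpha> * monomial \<alpha> z)"
    using assms(1) by (auto simp: polynomials_def)
  obtain B e where B: "finite B" and q: "q = (\<lambda>z. \<Sum>\<alpha>\<in>B. e \<alpha> * monomial \<alpha> z)"
    using assms(2) by (auto simp: polynomials_def)
  define c' e' where "c' \<alpha> = (if \<alpha> \<in> A then c \<alpha> else 0)" and "e' \<alpha> = (if \<alpha> \<in> B then e \<alpha> else 0)" for \<alpha>
  have "p z = (\<Sum>\<alpha>\<in>A \<union> B. c' \<alpha> * monomial \<alpha> z)" for z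
    unfolding p using A B by (intro sum.mono_neutral_cong_left) (auto simp: c'_def)
  moreover have "q z = (\<Sum>\<alpha>\<in>A \<union> B. e' \<alpha> * monomial \<alpha> z)" for z
    unfolding q using A B by (intro sum.mono_neutral_cong_left) (auto simp: e'_def)
  ultimately have "(\<lambda>z. a * p z + b * q z) = (\<lambda>z. \<Sum>\<alpha>\<in>A \<union> B. (a * c' \<alpha> + b * e' \<alpha>) * monomial \<alpha> z)"
    by (simp add: sum_distrib_left sum.distrib distrib_right mult.assoc)
  moreover have "finite (A \<union> B)" using A B by simp
  ultimately show ?thesis by (simp only: polynomialsI)
qed

lemma monomial_polynomials: "monomial \<alpha> \<in> polynomials"
  using polynomialsI[of "{\<alpha>}" "\<lambda>_. 1"] by simp

lemma zero_polynomials: "(\<lambda>z. 0) \<in> polynomials"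
  using polynomialsI[of "{}"] by simp

lemma polynomial_forms_linear_combination:
  assumes "\<omega> \<in> polynomial_forms" "\<eta> \<in> polynomial_forms"
  shows "(\<lambda>j z. a * \<omega> j z + b * \<eta> j z) \<in> polynomial_forms"
  using assms polynomials_linear_combination unfolding polynomial_forms_def by blast

lemma monomial_form_polynomial: "monomial_form \<alpha> j \<in> polynomial_forms"
proof -
  have "monomial_form \<alpha> j k = (if k = j then monomial \<alpha> else (\<lambda>z. 0))" for k
    by (auto simp: monomial_form_def)
  then show ?thesis by (simp add: polynomial_forms_def monomial_polynomials zero_polynomials)
qed

text \<open>
  Polynomial forms are written as finite sums over pairs \<open>(\<alpha>, j)\<close> standing for \<open>z\<^sup>\<alpha> dz\<^sup>*\<^sub>j\<close>, the index
  set on which the torus weights live.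
\<close>

definition form_of :: "(('n::finite \<Rightarrow> nat) \<times> 'n \<Rightarrow> complex) \<Rightarrow> (('n \<Rightarrow> nat) \<times> 'n) set \<Rightarrow> 'n form01" where
  "form_of u F = (\<lambda>k z. \<Sum>p\<in>F. u p * monomial_form (fst p) (snd p) k z)"

lemma form_of_insert:
  assumes "finite F" "p \<notin> F"
  shows "form_of u (insert p F) = (\<lambda>k z. u p * monomial_form (fst p) (snd p) k z + 1 * form_of u F k z)"
  using assms by (simp add: form_of_def)

lemma form_of_polynomial: "finite F \<Longrightarrow> form_of u F \<in> polynomial_forms"
proof (induction F rule: finite_induct)
  case empty
  show ?case by (simp add: form_of_def polynomial_forms_def zero_polynomials)
next
  case (insert p F)
  show ?case unfolding form_of_insert[OF insert.hyps(1,2)]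
    by (intro polynomial_forms_linear_combination monomial_form_polynomial insert.IH)
qed

lemma form_of_component:
  assumes "finite F"
  shows "form_of u F k z = (\<Sum>p\<in>{p \<in> F. snd p = k}. u p * monomial (fst p) z)"
  unfolding form_of_def using assms
  by (intro sum.mono_neutral_cong_right) (auto simp: monomial_form_def)

context rotation_invariant_measure
begin

lemma polynomials_L2: "p \<in> polynomials \<Longrightarrow> p \<in> L2 M"
  unfolding polynomials_def by (auto intro!: L2_sum L2_scale monomial_L2)

lemma polynomials_A2: "p \<in> polynomials \<Longrightarrow> p \<in> A2 M"
  unfolding A2_def using polynomials_L2 by (force simp: L2_norm_zero)

lemma A2_L2: "f \<in> A2 M \<Longrightarrow> f \<in> L2 M"
  by (simp add: A2_def)

lemma A2_approx:
  assumes "f \<in> A2 M" "0 < \<epsilon>"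
  obtains p where "p \<in> polynomials" "L2_norm M (\<lambda>z. f z - p z) < \<epsilon>"
proof -
  have "\<exists>p\<in>polynomials \<inter> L2 M. L2_norm M (\<lambda>z. f z - p z) < \<epsilon>"
    using assms by (simp add: A2_def)
  then show ?thesis using that by auto
qed

lemma A2_linear_combination:
  assumes f: "f \<in> A2 M" and g: "g \<in> A2 M"
  shows "(\<lambda>z. a * f z + b * g z) \<in> A2 M"
proof -
  have "\<exists>p\<in>polynomials \<inter> L2 M. L2_norm M (\<lambda>z. (a * f z + b * g z) - p z) < \<epsilon>" if "0 < \<epsilon>" for \<epsilon>
  proof -
    define \<eta> where "\<eta> = \<epsilon> / (cmod a + cmod b + 1)"
    have s: "0 < cmod a + cmod b + 1" by (simp add: add_nonneg_pos)
    then have "0 < \<eta>" using that by (simp add: \<eta>_def)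
    obtain p where p: "p \<in> polynomials" "L2_norm M (\<lambda>z. f z - p z) < \<eta>"
      using A2_approx[OF f \<open>0 < \<eta>\<close>] .
    obtain q where q: "q \<in> polynomials" "L2_norm M (\<lambda>z. g z - q z) < \<eta>"
      using A2_approx[OF g \<open>0 < \<eta>\<close>] .
    have "L2_norm M (\<lambda>z. (a * f z + b * g z) - (a * p z + b * q z))
        = L2_norm M (\<lambda>z. a * (f z - p z) + b * (g z - q z))"
      by (simp add: algebra_simps)
    also have "\<dots> \<le> L2_norm M (\<lambda>z. a * (f z - p z)) + L2_norm M (\<lambda>z. b * (g z - q z))"
      by (intro L2_triangle L2_scale L2_diff A2_L2 f g polynomials_L2 p q)
    also have "\<dots> = cmod a * L2_norm M (\<lambda>z. f z - p z) + cmod b * L2_norm M (\<lambda>z. g z - q z)"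
      by (simp only: L2_norm_scale)
    also have "\<dots> \<le> cmod a * \<eta> + cmod b * \<eta>"
      using p(2) q(2) by (intro add_mono mult_left_mono) auto
    also have "\<dots> < (cmod a + cmod b + 1) * \<eta>"
      using \<open>0 < \<eta>\<close> by (simp add: algebra_simps)
    also have "\<dots> = \<epsilon>" using s by (simp add: \<eta>_def)
    finally show ?thesis
      using polynomials_linear_combination[OF p(1) q(1), of a b] polynomials_L2
      by (intro bexI[of _ "\<lambda>z. a * p z + b * q z"]) auto
  qed
  moreover have "(\<lambda>z. a * f z + b * g z) \<in> L2 M"
    by (intro L2_add L2_scale A2_L2 f g)
  ultimately show ?thesis by (simp add: A2_def)
qed

lemma A2_diff: "f \<in> A2 M \<Longrightarrow> g \<in> A2 M \<Longrightarrow> (\<lambda>z. f z - g z) \<in> A2 M"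
  using A2_linear_combination[of f g 1 "-1"] by simp

text \<open>
  Orthogonality to the monomials passes to the closure of the polynomials by the Cauchy--Schwarz
  inequality.
\<close>

lemma sol_orthogonal_A2:
  assumes "g \<in> A2 M"
  shows "L2_inner M (sol \<alpha> j) g = 0"
proof -
  have "cmod (L2_inner M (sol \<alpha> j) g) \<le> L2_norm M (sol \<alpha> j) * \<epsilon>" if \<epsilon>: "0 < \<epsilon>" for \<epsilon>
  proof -
    obtain p where p: "p \<in> polynomials" "L2_norm M (\<lambda>z. g z - p z) < \<epsilon>"
      using A2_approx[OF assms \<epsilon>] .
    obtain A c where "p = (\<lambda>z. \<Sum>\<alpha>\<in>A. c \<alpha> * monomial \<alpha> z)"
      using p(1) by (auto simp: polynomials_def)
    then have "L2_inner M (sol \<alpha> j) p = 0"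
      by (simp add: L2_inner_sum_right L2_scale monomial_L2 sol_L2 L2_inner_scale_right sol_orthogonal_monomial)
    then have "L2_inner M (sol \<alpha> j) g = L2_inner M (sol \<alpha> j) (\<lambda>z. g z - p z)"
      by (simp add: L2_inner_diff_right A2_L2[OF assms] polynomials_L2 p(1) sol_L2)
    also have "cmod \<dots> \<le> L2_norm M (sol \<alpha> j) * L2_norm M (\<lambda>z. g z - p z)"
      by (intro L2_Cauchy_Schwarz sol_L2 L2_diff A2_L2 assms polynomials_L2 p(1))
    also have "\<dots> \<le> L2_norm M (sol \<alpha> j) * \<epsilon>"
      using p(2) L2_norm_nonneg by (intro mult_left_mono) auto
    finally show ?thesis .
  qed
  then have "\<forall>\<^sub>F \<epsilon> in at_right 0. cmod (L2_inner M (sol \<alpha> j) g) \<le> L2_norm M (sol \<alpha> j) * \<epsilon>"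
    by (auto simp: eventually_at_right_field intro: exI[of _ 1])
  moreover have "((\<lambda>\<epsilon>. L2_norm M (sol \<alpha> j) * \<epsilon>) \<longlongrightarrow> L2_norm M (sol \<alpha> j) * 0) (at_right 0)"
    by (intro tendsto_intros)
  ultimately have "cmod (L2_inner M (sol \<alpha> j) g) \<le> L2_norm M (sol \<alpha> j) * 0"
    by (intro tendsto_lowerbound) auto
  then show ?thesis by simp
qed

lemma sol_minus_conj_mult_A2: "(\<lambda>z. sol \<alpha> j z - cnj (z $ j) * monomial \<alpha> z) \<in> A2 M"
proof -
  have "(\<lambda>z. sol \<alpha> j z - cnj (z $ j) * monomial \<alpha> z)
      = (\<lambda>z. (- (if \<alpha> j = 0 then 0 else of_real (monomial_norm2 \<alpha> / monomial_norm2 (lower j \<alpha>))))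
          * monomial (lower j \<alpha>) z + 0 * monomial (lower j \<alpha>) z)"
    by (auto simp: sol_def conj_mult_def)
  also have "\<dots> \<in> A2 M"
    by (intro polynomials_A2 polynomials_linear_combination monomial_polynomials)
  finally show ?thesis .
qed

section \<open>Existence and uniqueness of the canonical solution operator\<close>

text \<open>
  Reading off coefficients by inner products makes them depend linearly on the polynomial as a
  function, independently of the expression that defines it.
\<close>

definition coef :: "(complex ^ 'n \<Rightarrow> complex) \<Rightarrow> ('n \<Rightarrow> nat) \<Rightarrow> complex" where
  "coef f \<alpha> = L2_inner M f (monomial \<alpha>) / of_real (monomial_norm2 \<alpha>)"

lemma coef_expansion:
  assumes "finite A"
  shows "coef (\<lambda>z. \<Sum>\<alpha>\<in>A. c \<alpha> * monomial \<alpha> z) \<beta> = (if \<beta> \<in> A then c \<beta> else 0)"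
proof -
  have "L2_inner M (\<lambda>z. \<Sum>\<alpha>\<in>A. c \<alpha> * monomial \<alpha> z) (monomial \<beta>)
      = (\<Sum>\<alpha>\<in>A. c \<alpha> * L2_inner M (monomial \<alpha>) (monomial \<beta>))"
    by (simp add: L2_inner_sum_left L2_scale monomial_L2 L2_inner_scale_left)
  also have "\<dots> = (\<Sum>\<alpha>\<in>A. if \<alpha> = \<beta> then c \<beta> * of_real (monomial_norm2 \<beta>) else 0)"
    by (intro sum.cong refl) (auto simp: inner_monomial)
  also have "\<dots> = (if \<beta> \<in> A then c \<beta> * of_real (monomial_norm2 \<beta>) else 0)"
    using assms by simp
  finally show ?thesis
    using monomial_norm2_pos[of \<beta>] by (simp add: coef_def)
qed

lemma coef_monomial: "coef (monomial \<alpha>) \<beta> = (if \<beta> = \<alpha> then 1 else 0)"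
  using coef_expansion[of "{\<alpha>}" "\<lambda>_. 1" \<beta>] by simp

lemma coef_linear_combination:
  "f \<in> L2 M \<Longrightarrow> g \<in> L2 M \<Longrightarrow> coef (\<lambda>z. a * f z + b * g z) \<alpha> = a * coef f \<alpha> + b * coef g \<alpha>"
  by (simp add: coef_def L2_inner_add_left L2_scale monomial_L2 L2_inner_scale_left add_divide_distrib)

text \<open>
  The linear extension of \<open>sol\<close> to polynomial forms, which shows that a canonical solution operator exists.
\<close>

definition solve :: "'n form01 \<Rightarrow> complex ^ 'n \<Rightarrow> complex" where
  "solve \<omega> z = (\<Sum>j\<in>UNIV. \<Sum>\<alpha> | coef (\<omega> j) \<alpha> \<noteq> 0. coef (\<omega> j) \<alpha> * sol \<alpha> j z)"

definition support :: "'n form01 \<Rightarrow> ('n \<Rightarrow> nat) set" where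
  "support \<omega> = {\<alpha>. \<exists>j. coef (\<omega> j) \<alpha> \<noteq> 0}"

lemma polynomial_coef_expansion:
  assumes "p \<in> polynomials"
  shows "finite {\<alpha>. coef p \<alpha> \<noteq> 0}"
    and "p = (\<lambda>z. \<Sum>\<alpha> | coef p \<alpha> \<noteq> 0. coef p \<alpha> * monomial \<alpha> z)"
proof -
  obtain A c where A: "finite A" and p: "p = (\<lambda>z. \<Sum>\<alpha>\<in>A. c \<alpha> * monomial \<alpha> z)"
    using assms unfolding polynomials_def by blast
  have coef: "coef p \<alpha> = (if \<alpha> \<in> A then c \<alpha> else 0)" for \<alpha>
    unfolding p using A by (rule coef_expansion)
  then have sub: "{\<alpha>. coef p \<alpha> \<noteq> 0} \<subseteq> A" by (auto split: if_splits)
  then show "finite {\<alpha>. coef p \<alpha> \<noteq> 0}" using A by (rule finite_subset)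
  have "(\<Sum>\<alpha>\<in>A. c \<alpha> * monomial \<alpha> z) = (\<Sum>\<alpha> | coef p \<alpha> \<noteq> 0. coef p \<alpha> * monomial \<alpha> z)" for z
    using A sub by (intro sum.mono_neutral_cong_right) (auto simp: coef)
  then show "p = (\<lambda>z. \<Sum>\<alpha> | coef p \<alpha> \<noteq> 0. coef p \<alpha> * monomial \<alpha> z)"
    by (subst p) (rule ext)
qed

lemma support_finite:
  assumes "\<omega> \<in> polynomial_forms"
  shows "finite (support \<omega>)"
proof -
  have "support \<omega> = (\<Union>j. {\<alpha>. coef (\<omega> j) \<alpha> \<noteq> 0})" by (auto simp: support_def)
  then show ?thesis
    using assms polynomial_coef_expansion(1) by (simp add: polynomial_forms_def)
qed

lemma polynomial_form_expansion:
  assumes "\<omega> \<in> polynomial_forms"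
  shows "\<omega> = form_of (\<lambda>p. coef (\<omega> (snd p)) (fst p)) (support \<omega> \<times> UNIV)"
proof (intro ext)
  fix j z
  have "\<omega> j \<in> polynomials" using assms by (simp add: polynomial_forms_def)
  then have "\<omega> j z = (\<Sum>\<alpha> | coef (\<omega> j) \<alpha> \<noteq> 0. coef (\<omega> j) \<alpha> * monomial \<alpha> z)"
    using polynomial_coef_expansion(2) by meson
  also have "\<dots> = (\<Sum>\<alpha>\<in>support \<omega>. coef (\<omega> j) \<alpha> * monomial \<alpha> z)"
    using support_finite[OF assms] by (intro sum.mono_neutral_left) (auto simp: support_def)
  also have "\<dots> = (\<Sum>\<alpha>\<in>support \<omega>. \<Sum>k\<in>UNIV. coef (\<omega> k) \<alpha> * monomial_form \<alpha> k j z)"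
    by (intro sum.cong refl) (simp add: monomial_form_def if_distrib cong: if_cong)
  also have "\<dots> = form_of (\<lambda>p. coef (\<omega> (snd p)) (fst p)) (support \<omega> \<times> UNIV) j z"
    by (simp add: form_of_def sum.cartesian_product case_prod_unfold)
  finally show "\<omega> j z = form_of (\<lambda>p. coef (\<omega> (snd p)) (fst p)) (support \<omega> \<times> UNIV) j z" .
qed

lemma solve_expansion:
  assumes "finite B" "support \<omega> \<subseteq> B"
  shows "solve \<omega> z = (\<Sum>p\<in>B \<times> UNIV. coef (\<omega> (snd p)) (fst p) * sol (fst p) (snd p) z)"
proof -
  have "solve \<omega> z = (\<Sum>j\<in>UNIV. \<Sum>\<alpha>\<in>B. coef (\<omega> j) \<alpha> * sol \<alpha> j z)"
    unfolding solve_def using assms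
    by (intro sum.cong refl sum.mono_neutral_left) (auto simp: support_def)
  also have "\<dots> = (\<Sum>\<alpha>\<in>B. \<Sum>j\<in>UNIV. coef (\<omega> j) \<alpha> * sol \<alpha> j z)"
    by (rule sum.swap)
  finally show ?thesis
    by (simp add: sum.cartesian_product case_prod_unfold)
qed

lemma solve_canonical: "is_canonical_solution_operator M solve"
  unfolding is_canonical_solution_operator_def
proof (intro conjI ballI allI)
  show "solve \<omega> \<in> L2 M" for \<omega>
    unfolding solve_def[abs_def] by (intro L2_sum L2_scale sol_L2)
  show "linear_on_forms M polynomial_forms solve"
    unfolding linear_on_forms_def
  proof (intro ballI allI AE_I2)
    fix \<omega> \<eta> :: "'n form01" and a b z
    assume \<omega>: "\<omega> \<in> polynomial_forms" and \<eta>: "\<eta> \<in> polynomial_forms"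
    define \<theta> where "\<theta> = (\<lambda>j z. a * \<omega> j z + b * \<eta> j z)"
    have \<theta>: "\<theta> \<in> polynomial_forms"
      unfolding \<theta>_def using \<omega> \<eta> by (rule polynomial_forms_linear_combination)
    define B where "B = support \<omega> \<union> support \<eta> \<union> support \<theta>"
    have B: "finite B" "support \<omega> \<subseteq> B" "support \<eta> \<subseteq> B" "support \<theta> \<subseteq> B"
      using support_finite \<omega> \<eta> \<theta> by (auto simp: B_def)
    have "coef (\<theta> j) \<alpha> = a * coef (\<omega> j) \<alpha> + b * coef (\<eta> j) \<alpha>" for j \<alpha>
      unfolding \<theta>_def using \<omega> \<eta>
      by (intro coef_linear_combination polynomials_L2) (auto simp: polynomial_forms_def)
    then have "solve \<theta> z = a * solve \<omega> z + b * solve \<eta> z"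
      unfolding solve_expansion[OF B(1,2)] solve_expansion[OF B(1,3)] solve_expansion[OF B(1,4)]
      by (simp add: sum.distrib sum_distrib_left distrib_right mult.assoc)
    then show "solve (\<lambda>j z. a * \<omega> j z + b * \<eta> j z) z = a * solve \<omega> z + b * solve \<eta> z"
      by (simp add: \<theta>_def)
  qed
next
  fix \<alpha> j
  have "coef (monomial_form \<alpha> j k) \<beta> = (if k = j \<and> \<beta> = \<alpha> then 1 else 0)" for k \<beta>
  proof (cases "k = j")
    case True
    then have "monomial_form \<alpha> j k = monomial \<alpha>" by (auto simp: monomial_form_def)
    then show ?thesis using True by (simp add: coef_monomial)
  next
    case False
    then have "monomial_form \<alpha> j k = (\<lambda>z. 0)" by (auto simp: monomial_form_def)
    then show ?thesis using False by (simp add: coef_def L2_inner_def)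
  qed
  then have "solve (monomial_form \<alpha> j) z = (\<Sum>k\<in>UNIV. \<Sum>\<beta>\<in>(if k = j then {\<alpha>} else {}). sol \<beta> k z)" for z
    unfolding solve_def by (intro sum.cong) (auto split: if_splits)
  also have "(\<Sum>k\<in>UNIV. \<Sum>\<beta>\<in>(if k = j then {\<alpha>} else {}). sol \<beta> k z) = (\<Sum>k\<in>UNIV. if k = j then sol \<alpha> j z else 0)" for z
    by (intro sum.cong) auto
  finally have eq: "solve (monomial_form \<alpha> j) = sol \<alpha> j" by (auto simp: fun_eq_iff)
  show "(\<lambda>z. solve (monomial_form \<alpha> j) z - cnj (z $ j) * monomial \<alpha> z) \<in> A2 M"
    unfolding eq by (rule sol_minus_conj_mult_A2)
  show "L2_inner M (solve (monomial_form \<alpha> j)) g = 0" if "g \<in> A2 M" for g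
    unfolding eq using that by (rule sol_orthogonal_A2)
qed

lemma canonical_solution_operator_canonical:
  "is_canonical_solution_operator M (canonical_solution_operator M)"
  unfolding canonical_solution_operator_def
  by (rule someI[where P = "is_canonical_solution_operator M", OF solve_canonical])

text \<open>
  The difference of two canonical solutions lies in the closure of the polynomials and is
  orthogonal to it, hence to itself.
\<close>

lemma canonical_monomial_form:
  assumes "is_canonical_solution_operator M S"
  shows "AE z in M. S (monomial_form \<alpha> j) z = sol \<alpha> j z"
proof -
  let ?f = "S (monomial_form \<alpha> j)"
  have f: "?f \<in> L2 M" "(\<lambda>z. ?f z - cnj (z $ j) * monomial \<alpha> z) \<in> A2 M"
    and orth: "\<And>g. g \<in> A2 M \<Longrightarrow> L2_inner M ?f g = 0"
    using assms monomial_form_polynomial by (auto simp: is_canonical_solution_operator_def)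
  define h where "h z = ?f z - sol \<alpha> j z" for z
  have "(\<lambda>z. (?f z - cnj (z $ j) * monomial \<alpha> z) - (sol \<alpha> j z - cnj (z $ j) * monomial \<alpha> z)) \<in> A2 M"
    by (intro A2_diff f(2) sol_minus_conj_mult_A2)
  then have h: "h \<in> A2 M" by (simp add: h_def[abs_def])
  have "L2_inner M h h = L2_inner M ?f h - L2_inner M (sol \<alpha> j) h"
    unfolding h_def[abs_def] using A2_L2[OF h] f(1)
    by (intro L2_inner_diff_left sol_L2) (simp_all add: h_def[abs_def])
  also have "\<dots> = 0" using h by (simp add: orth sol_orthogonal_A2)
  finally have "L2_norm M h = 0" by (simp add: L2_inner_self)
  then have "AE z in M. h z = 0" using A2_L2[OF h] by (intro L2_norm_eq_0_AE)
  then show ?thesis by (simp add: h_def)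
qed

lemma canonical_form_of:
  assumes S: "is_canonical_solution_operator M S" and "finite F"
  shows "AE z in M. S (form_of u F) z = (\<Sum>p\<in>F. u p * sol (fst p) (snd p) z)"
  using \<open>finite F\<close>
proof (induction F rule: finite_induct)
  have lin: "linear_on_forms M polynomial_forms S"
    using S by (simp add: is_canonical_solution_operator_def)
  {
    case empty
    have "form_of u {} \<in> polynomial_forms" by (rule form_of_polynomial) simp
    then have "AE z in M. S (\<lambda>j z. 0 * form_of u {} j z + 0 * form_of u {} j z) z
        = 0 * S (form_of u {}) z + 0 * S (form_of u {}) z"
      using lin unfolding linear_on_forms_def by blast
    then show ?case by (simp add: form_of_def)
  next
    case (insert p F)
    have "AE z in M. S (\<lambda>j z. u p * monomial_form (fst p) (snd p) j z + 1 * form_of u F j z) z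
        = u p * S (monomial_form (fst p) (snd p)) z + 1 * S (form_of u F) z"
      using lin monomial_form_polynomial form_of_polynomial[OF insert.hyps(1)]
      unfolding linear_on_forms_def by blast
    then show ?case
      unfolding form_of_insert[OF insert.hyps(1,2), symmetric]
      using insert.IH canonical_monomial_form[OF S, of "fst p" "snd p"]
      by eventually_elim (simp add: insert.hyps)
  }
qed

lemma form_norm_form_of:
  assumes "finite F"
  shows "(form_norm M (form_of u F))\<^sup>2 = (\<Sum>p\<in>F. (cmod (u p))\<^sup>2 * monomial_norm2 (fst p))"
proof -
  have norm: "(L2_norm M (monomial \<alpha>))\<^sup>2 = monomial_norm2 \<alpha>" for \<alpha>
    by (simp add: L2_norm_square monomial_norm2_def)
  have "(L2_norm M (form_of u F k))\<^sup>2 = (\<Sum>p\<in>{p \<in> F. snd p = k}. (cmod (u p))\<^sup>2 * monomial_norm2 (fst p))" for k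
  proof -
    have "form_of u F k = (\<lambda>z. \<Sum>p\<in>{p \<in> F. snd p = k}. u p * monomial (fst p) z)"
      using form_of_component[OF assms] by blast
    then have "(L2_norm M (form_of u F k))\<^sup>2 = (\<Sum>p\<in>{p \<in> F. snd p = k}. (L2_norm M (\<lambda>z. u p * monomial (fst p) z))\<^sup>2)"
      using assms
      by (simp only:) (intro L2_Pythagoras L2_scale monomial_L2,
        auto simp: L2_inner_scale_left L2_inner_scale_right inner_monomial prod_eq_iff)
    then show ?thesis by (simp add: L2_norm_scale power_mult_distrib norm)
  qed
  then have "(form_norm M (form_of u F))\<^sup>2 = (\<Sum>k\<in>UNIV. \<Sum>p\<in>{p \<in> F. snd p = k}. (cmod (u p))\<^sup>2 * monomial_norm2 (fst p))"
    by (simp add: form_norm_def sum_nonneg less_imp_le[OF monomial_norm2_pos])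
  also have "\<dots> = (\<Sum>p\<in>F. (cmod (u p))\<^sup>2 * monomial_norm2 (fst p))"
    using assms by (intro sum.group) auto
  finally show ?thesis .
qed

end

section \<open>Extension by continuity\<close>

lemma form_norm_L2_set: "form_norm M \<omega> = L2_set (\<lambda>j. L2_norm M (\<omega> j)) UNIV"
  by (simp add: form_norm_def L2_set_def)

lemma form_norm_nonneg: "0 \<le> form_norm M \<omega>"
  by (simp add: form_norm_def sum_nonneg)

lemma form_norm_triangle:
  assumes "\<And>j. \<omega> j \<in> L2 M" "\<And>j. \<eta> j \<in> L2 M"
  shows "form_norm M (\<lambda>j z. \<omega> j z + \<eta> j z) \<le> form_norm M \<omega> + form_norm M \<eta>"
proof -
  have "form_norm M (\<lambda>j z. \<omega> j z + \<eta> j z) \<le> L2_set (\<lambda>j. L2_norm M (\<omega> j) + L2_norm M (\<eta> j)) UNIV"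
    unfolding form_norm_L2_set using assms by (intro L2_set_mono L2_triangle L2_norm_nonneg)
  also have "\<dots> \<le> form_norm M \<omega> + form_norm M \<eta>"
    unfolding form_norm_L2_set by (rule L2_set_triangle_ineq)
  finally show ?thesis .
qed

lemma form_norm_scale: "form_norm M (\<lambda>j z. a * \<omega> j z) = cmod a * form_norm M \<omega>"
  by (simp add: form_norm_L2_set L2_norm_scale L2_set_right_distrib)

lemma form_norm_minus_commute:
  "form_norm M (\<lambda>j z. \<omega> j z - \<eta> j z) = form_norm M (\<lambda>j z. \<eta> j z - \<omega> j z)"
  unfolding form_norm_L2_set by (intro L2_set_cong refl L2_norm_minus_commute)

context rotation_invariant_measure
begin

lemma A2_01_L2: "\<omega> \<in> A2_01 M \<Longrightarrow> \<omega> j \<in> L2 M"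
  by (simp add: A2_01_def A2_L2)

lemma polynomial_forms_A2_01: "\<omega> \<in> polynomial_forms \<Longrightarrow> \<omega> \<in> A2_01 M"
  by (simp add: A2_01_def polynomial_forms_def polynomials_A2)

lemma A2_01_linear_combination:
  "\<omega> \<in> A2_01 M \<Longrightarrow> \<eta> \<in> A2_01 M \<Longrightarrow> (\<lambda>j z. a * \<omega> j z + b * \<eta> j z) \<in> A2_01 M"
  by (simp add: A2_01_def A2_linear_combination)

lemma form_norm_triangle_diff:
  assumes "\<And>j. \<omega> j \<in> L2 M" "\<And>j. \<eta> j \<in> L2 M" "\<And>j. \<theta> j \<in> L2 M"
  shows "form_norm M (\<lambda>j z. \<omega> j z - \<theta> j z)
    \<le> form_norm M (\<lambda>j z. \<omega> j z - \<eta> j z) + form_norm M (\<lambda>j z. \<eta> j z - \<theta> j z)"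
proof -
  have "form_norm M (\<lambda>j z. (\<omega> j z - \<eta> j z) + (\<eta> j z - \<theta> j z))
      \<le> form_norm M (\<lambda>j z. \<omega> j z - \<eta> j z) + form_norm M (\<lambda>j z. \<eta> j z - \<theta> j z)"
    using assms by (intro form_norm_triangle L2_diff)
  then show ?thesis by simp
qed

lemma L2_norm_triangle_diff:
  assumes "f \<in> L2 M" "g \<in> L2 M" "h \<in> L2 M"
  shows "L2_norm M (\<lambda>z. f z - h z) \<le> L2_norm M (\<lambda>z. f z - g z) + L2_norm M (\<lambda>z. g z - h z)"
  using L2_triangle[OF L2_diff[OF assms(1,2)] L2_diff[OF assms(2,3)]] by simp

lemma polynomial_forms_dense:
  assumes \<omega>: "\<omega> \<in> A2_01 M" and \<epsilon>: "0 < \<epsilon>"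
  shows "\<exists>p\<in>polynomial_forms. form_norm M (\<lambda>j z. \<omega> j z - p j z) < \<epsilon>"
proof -
  have "\<forall>j. \<exists>p. p \<in> polynomials \<and> L2_norm M (\<lambda>z. \<omega> j z - p z) < \<epsilon> / CARD('n)"
  proof
    fix j
    have "\<omega> j \<in> A2 M" "0 < \<epsilon> / CARD('n)" using \<omega> \<epsilon> by (auto simp: A2_01_def)
    then obtain p where "p \<in> polynomials" "L2_norm M (\<lambda>z. \<omega> j z - p z) < \<epsilon> / CARD('n)"
      by (rule A2_approx)
    then show "\<exists>p. p \<in> polynomials \<and> L2_norm M (\<lambda>z. \<omega> j z - p z) < \<epsilon> / CARD('n)" by blast
  qed
  then obtain p where p: "\<And>j. p j \<in> polynomials" "\<And>j. L2_norm M (\<lambda>z. \<omega> j z - p j z) < \<epsilon> / CARD('n)"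
    by metis
  have "form_norm M (\<lambda>j z. \<omega> j z - p j z) \<le> (\<Sum>j\<in>UNIV. L2_norm M (\<lambda>z. \<omega> j z - p j z))"
    unfolding form_norm_L2_set by (intro L2_set_le_sum L2_norm_nonneg)
  also have "\<dots> < (\<Sum>j\<in>(UNIV::'n set). \<epsilon> / CARD('n))"
    using p(2) by (intro sum_strict_mono) auto
  also have "\<dots> = \<epsilon>" by simp
  finally have "form_norm M (\<lambda>j z. \<omega> j z - p j z) < \<epsilon>" .
  moreover have "p \<in> polynomial_forms" using p(1) by (simp add: polynomial_forms_def)
  ultimately show ?thesis by blast
qed

text \<open>
  A characterization of the value at \<open>\<omega>\<close> of the continuous extension of \<open>S\<close> that does not mention an
  approximating sequence. It determines the value up to null sets, so values chosen
  independently for different forms still depend linearly on the form.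
\<close>

definition extends_at :: "('n form01 \<Rightarrow> complex ^ 'n \<Rightarrow> complex) \<Rightarrow> real \<Rightarrow> 'n form01
    \<Rightarrow> (complex ^ 'n \<Rightarrow> complex) \<Rightarrow> bool" where
  "extends_at S C \<omega> g \<longleftrightarrow> g \<in> L2 M \<and>
     (\<forall>p\<in>polynomial_forms. L2_norm M (\<lambda>z. g z - S p z) \<le> C * form_norm M (\<lambda>j z. \<omega> j z - p j z))"

text \<open>
  The value at a form exists as the limit of the images of polynomial forms converging fast
  to it. The extension agrees with \<open>S\<close> on a polynomial form because that form approximates itself, its
  bound follows by comparison with the zero form, and linearity follows by comparing with a
  linear combination of polynomial approximations.
\<close>

lemma bounded_extension:
  assumes SL: "\<And>\<omega>. \<omega> \<in> polynomial_forms \<Longrightarrow> S \<omega> \<in> L2 M"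
    and lin: "linear_on_forms M polynomial_forms S"
    and C: "0 \<le> C"
    and bound: "\<And>\<omega>. \<omega> \<in> polynomial_forms \<Longrightarrow> L2_norm M (S \<omega>) \<le> C * form_norm M \<omega>"
  shows "bounded_on_A2_01 M S"
proof -
  have pL: "p j \<in> L2 M" if "p \<in> polynomial_forms" for p j
    using that by (intro A2_01_L2 polynomial_forms_A2_01)
  have diff: "L2_norm M (\<lambda>z. S p z - S q z) \<le> C * form_norm M (\<lambda>j z. p j z - q j z)"
    if p: "p \<in> polynomial_forms" and q: "q \<in> polynomial_forms" for p q
  proof -
    have pq: "(\<lambda>j z. 1 * p j z + -1 * q j z) \<in> polynomial_forms"
      using p q by (rule polynomial_forms_linear_combination)
    have "AE z in M. S (\<lambda>j z. 1 * p j z + -1 * q j z) z = 1 * S p z + -1 * S q z"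
      using lin p q unfolding linear_on_forms_def by blast
    then have "L2_norm M (\<lambda>z. S p z - S q z) = L2_norm M (S (\<lambda>j z. 1 * p j z + -1 * q j z))"
      by (intro L2_norm_cong_AE L2_measurable L2_diff SL p q pq) (simp add: eq_commute)
    also have "\<dots> \<le> C * form_norm M (\<lambda>j z. 1 * p j z + -1 * q j z)"
      by (rule bound[OF pq])
    finally show ?thesis by simp
  qed
  have ex: "\<exists>g. extends_at S C \<omega> g" if \<omega>: "\<omega> \<in> A2_01 M" for \<omega>
  proof -
    (* Two consecutive errors, multiplied by the bound C, must add up to at most (1/2) ^ n, as
       completeness asks; adding 1 to C avoids division by 0. *)
    define \<epsilon> where "\<epsilon> n = (1/2) ^ n / (2 * (C + 1))" for n :: nat
    have \<epsilon>0: "0 < \<epsilon> n" for n using C by (simp add: \<epsilon>_def)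
    have "\<forall>n. \<exists>p. p \<in> polynomial_forms \<and> form_norm M (\<lambda>j z. \<omega> j z - p j z) < \<epsilon> n"
      using polynomial_forms_dense[OF \<omega> \<epsilon>0] by blast
    then obtain p where p: "\<And>n. p n \<in> polynomial_forms"
      and near: "\<And>n. form_norm M (\<lambda>j z. \<omega> j z - p n j z) < \<epsilon> n"
      by metis
    have step: "L2_norm M (\<lambda>z. S (p (Suc n)) z - S (p n) z) \<le> (1/2) ^ n" for n
    proof -
      have "form_norm M (\<lambda>j z. p (Suc n) j z - p n j z)
          \<le> form_norm M (\<lambda>j z. p (Suc n) j z - \<omega> j z) + form_norm M (\<lambda>j z. \<omega> j z - p n j z)"
        by (intro form_norm_triangle_diff pL p A2_01_L2[OF \<omega>])
      also have "\<dots> \<le> \<epsilon> (Suc n) + \<epsilon> n"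
        using near[of n] near[of "Suc n"] by (simp add: form_norm_minus_commute[of M "p (Suc n)"])
      also have "\<dots> \<le> 2 * \<epsilon> n"
      proof -
        have "\<epsilon> (Suc n) = \<epsilon> n / 2" by (simp add: \<epsilon>_def)
        then show ?thesis using \<epsilon>0[of n] by simp
      qed
      finally have "C * form_norm M (\<lambda>j z. p (Suc n) j z - p n j z) \<le> C * (2 * \<epsilon> n)"
        using C by (rule mult_left_mono)
      also have "\<dots> \<le> (C + 1) * (2 * \<epsilon> n)"
        using \<epsilon>0[of n] by (intro mult_right_mono) auto
      also have "\<dots> = (1/2) ^ n"
      proof -
        have "(C + 1) * (2 * (x / (2 * (C + 1)))) = x" for x
          using C by (simp add: field_simps)
        then show ?thesis unfolding \<epsilon>_def .
      qed
      finally show ?thesis using diff[OF p p, of "Suc n" n] by linarith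
    qed
    obtain h where h: "h \<in> L2 M" and lim: "(\<lambda>n. L2_norm M (\<lambda>z. S (p n) z - h z)) \<longlonglongrightarrow> 0"
      using L2_complete[OF finite_measure_M SL[OF p] step] .
    have "L2_norm M (\<lambda>z. h z - S q z) \<le> C * form_norm M (\<lambda>j z. \<omega> j z - q j z)"
      if q: "q \<in> polynomial_forms" for q
    proof -
      let ?Q = "form_norm M (\<lambda>j z. \<omega> j z - q j z)"
      have "L2_norm M (\<lambda>z. h z - S q z) \<le> L2_norm M (\<lambda>z. S (p n) z - h z) + C * (\<epsilon> n + ?Q)" for n
      proof -
        have "L2_norm M (\<lambda>z. h z - S q z)
            \<le> L2_norm M (\<lambda>z. h z - S (p n) z) + L2_norm M (\<lambda>z. S (p n) z - S q z)"
          by (intro L2_norm_triangle_diff h SL p q)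
        moreover have "L2_norm M (\<lambda>z. S (p n) z - S q z) \<le> C * form_norm M (\<lambda>j z. p n j z - q j z)"
          by (rule diff[OF p q])
        moreover have "form_norm M (\<lambda>j z. p n j z - q j z)
            \<le> form_norm M (\<lambda>j z. p n j z - \<omega> j z) + ?Q"
          by (intro form_norm_triangle_diff pL p q A2_01_L2[OF \<omega>])
        then have "C * form_norm M (\<lambda>j z. p n j z - q j z) \<le> C * (\<epsilon> n + ?Q)"
          using near[of n] C by (intro mult_left_mono) (simp_all add: form_norm_minus_commute[of M "p n"])
        ultimately show ?thesis by (simp add: L2_norm_minus_commute[of M h])
      qed
      moreover have "(\<lambda>n. L2_norm M (\<lambda>z. S (p n) z - h z) + C * (\<epsilon> n + ?Q)) \<longlonglongrightarrow> 0 + C * (0 + ?Q)"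
      proof (intro tendsto_intros lim)
        show "\<epsilon> \<longlonglongrightarrow> 0"
          unfolding \<epsilon>_def[abs_def]
          by (intro tendsto_divide_zero LIMSEQ_power_zero) simp
      qed
      ultimately have "L2_norm M (\<lambda>z. h z - S q z) \<le> 0 + C * (0 + ?Q)"
        by (intro tendsto_lowerbound[OF _ always_eventually]) auto
      then show ?thesis by simp
    qed
    with h show ?thesis unfolding extends_at_def by blast
  qed
  define T where "T \<omega> = (SOME g. extends_at S C \<omega> g)" for \<omega>
  have T: "extends_at S C \<omega> (T \<omega>)" if "\<omega> \<in> A2_01 M" for \<omega>
    unfolding T_def using ex[OF that] by (rule someI_ex)
  have TL: "T \<omega> \<in> L2 M" if "\<omega> \<in> A2_01 M" for \<omega>
    using T[OF that] by (simp add: extends_at_def)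
  have TS: "L2_norm M (\<lambda>z. T \<omega> z - S p z) \<le> C * form_norm M (\<lambda>j z. \<omega> j z - p j z)"
    if "\<omega> \<in> A2_01 M" "p \<in> polynomial_forms" for \<omega> p
    using T[OF that(1)] that(2) by (simp add: extends_at_def)
  have agree: "AE z in M. T p z = S p z" if p: "p \<in> polynomial_forms" for p
  proof -
    have "L2_norm M (\<lambda>z. T p z - S p z) \<le> 0"
      using TS[OF polynomial_forms_A2_01[OF p] p] by (simp add: form_norm_def L2_norm_zero)
    then have "L2_norm M (\<lambda>z. T p z - S p z) = 0"
      using L2_norm_nonneg by (rule antisym)
    then have "AE z in M. T p z - S p z = 0"
      by (intro L2_norm_eq_0_AE L2_diff TL polynomial_forms_A2_01 SL p)
    then show ?thesis by simp
  qed
  have T_bound: "L2_norm M (T \<omega>) \<le> C * form_norm M \<omega>" if \<omega>: "\<omega> \<in> A2_01 M" for \<omega>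
  proof -
    let ?z = "\<lambda>(j::'n) (z::complex^'n). 0::complex"
    have zero: "?z \<in> polynomial_forms" by (simp add: polynomial_forms_def zero_polynomials)
    have "L2_norm M (S ?z) \<le> 0"
      using bound[OF zero] by (simp add: form_norm_def L2_norm_zero)
    moreover have "L2_norm M (\<lambda>z. (T \<omega> z - S ?z z) + S ?z z) \<le> L2_norm M (\<lambda>z. T \<omega> z - S ?z z) + L2_norm M (S ?z)"
      by (intro L2_triangle L2_diff TL \<omega> SL zero)
    moreover have "L2_norm M (\<lambda>z. T \<omega> z - S ?z z) \<le> C * form_norm M \<omega>"
      using TS[OF \<omega> zero] by simp
    ultimately show ?thesis by simp
  qed
  have "linear_on_forms M (A2_01 M) T"
    unfolding linear_on_forms_def
  proof (intro ballI allI)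
    fix \<omega> \<eta> :: "'n form01" and a b
    assume \<omega>: "\<omega> \<in> A2_01 M" and \<eta>: "\<eta> \<in> A2_01 M"
    define \<theta> where "\<theta> = (\<lambda>j z. a * \<omega> j z + b * \<eta> j z)"
    have \<theta>: "\<theta> \<in> A2_01 M" unfolding \<theta>_def using \<omega> \<eta> by (rule A2_01_linear_combination)
    define D where "D z = T \<theta> z - (a * T \<omega> z + b * T \<eta> z)" for z
    have DL: "D \<in> L2 M"
      unfolding D_def[abs_def] by (intro L2_diff L2_add L2_scale TL \<omega> \<eta> \<theta>)
    define K where "K = 2 * C * (cmod a + cmod b)"
    have K0: "0 \<le> K" using C by (simp add: K_def)
    have "L2_norm M D \<le> K * \<epsilon>" if \<epsilon>: "0 < \<epsilon>" for \<epsilon>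
    proof -
      obtain p where p: "p \<in> polynomial_forms" and np: "form_norm M (\<lambda>j z. \<omega> j z - p j z) < \<epsilon>"
        using polynomial_forms_dense[OF \<omega> \<epsilon>] by blast
      obtain q where q: "q \<in> polynomial_forms" and nq: "form_norm M (\<lambda>j z. \<eta> j z - q j z) < \<epsilon>"
        using polynomial_forms_dense[OF \<eta> \<epsilon>] by blast
      define r where "r = (\<lambda>j z. a * p j z + b * q j z)"
      have r: "r \<in> polynomial_forms"
        unfolding r_def using p q by (rule polynomial_forms_linear_combination)
      have Sr: "AE z in M. S r z = a * S p z + b * S q z"
        unfolding r_def using lin p q unfolding linear_on_forms_def by blast
      have "form_norm M (\<lambda>j z. \<theta> j z - r j z)
          = form_norm M (\<lambda>j z. a * (\<omega> j z - p j z) + b * (\<eta> j z - q j z))"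
        by (simp add: \<theta>_def r_def algebra_simps)
      also have "\<dots> \<le> form_norm M (\<lambda>j z. a * (\<omega> j z - p j z)) + form_norm M (\<lambda>j z. b * (\<eta> j z - q j z))"
        by (intro form_norm_triangle L2_scale L2_diff A2_01_L2 polynomial_forms_A2_01 \<omega> \<eta> p q)
      also have "\<dots> \<le> cmod a * \<epsilon> + cmod b * \<epsilon>"
        unfolding form_norm_scale using np nq by (intro add_mono mult_left_mono) auto
      finally have nr: "C * form_norm M (\<lambda>j z. \<theta> j z - r j z) \<le> C * (cmod a * \<epsilon> + cmod b * \<epsilon>)"
        using C by (rule mult_left_mono)
      have "L2_norm M D = L2_norm M (\<lambda>z. (T \<theta> z - S r z) + (a * (S p z - T \<omega> z) + b * (S q z - T \<eta> z)))"
      proof (rule L2_norm_cong_AE)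
        show "AE z in M. D z = (T \<theta> z - S r z) + (a * (S p z - T \<omega> z) + b * (S q z - T \<eta> z))"
          using Sr by eventually_elim (simp add: D_def algebra_simps)
      qed (intro L2_measurable DL L2_add L2_diff L2_scale TL SL \<theta> \<omega> \<eta> p q r)+
      also have "\<dots> \<le> L2_norm M (\<lambda>z. T \<theta> z - S r z)
          + L2_norm M (\<lambda>z. a * (S p z - T \<omega> z) + b * (S q z - T \<eta> z))"
        by (intro L2_triangle L2_add L2_diff L2_scale TL SL \<theta> \<omega> \<eta> p q r)
      also have "L2_norm M (\<lambda>z. a * (S p z - T \<omega> z) + b * (S q z - T \<eta> z))
          \<le> L2_norm M (\<lambda>z. a * (S p z - T \<omega> z)) + L2_norm M (\<lambda>z. b * (S q z - T \<eta> z))"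
        by (intro L2_triangle L2_add L2_diff L2_scale TL SL \<omega> \<eta> p q)
      also have "\<dots> = cmod a * L2_norm M (\<lambda>z. T \<omega> z - S p z) + cmod b * L2_norm M (\<lambda>z. T \<eta> z - S q z)"
        unfolding L2_norm_scale by (simp only: L2_norm_minus_commute[of M "S p"] L2_norm_minus_commute[of M "S q"])
      also have "\<dots> \<le> cmod a * (C * \<epsilon>) + cmod b * (C * \<epsilon>)"
      proof (intro add_mono mult_left_mono)
        show "L2_norm M (\<lambda>z. T \<omega> z - S p z) \<le> C * \<epsilon>"
          using TS[OF \<omega> p] mult_left_mono[OF less_imp_le[OF np] C] by linarith
        show "L2_norm M (\<lambda>z. T \<eta> z - S q z) \<le> C * \<epsilon>"
          using TS[OF \<eta> q] mult_left_mono[OF less_imp_le[OF nq] C] by linarith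
      qed auto
      also have "L2_norm M (\<lambda>z. T \<theta> z - S r z) \<le> C * (cmod a * \<epsilon> + cmod b * \<epsilon>)"
        using TS[OF \<theta> r] nr by linarith
      finally show ?thesis by (simp add: K_def algebra_simps)
    qed
    then have "\<forall>\<^sub>F \<epsilon> in at_right 0. L2_norm M D \<le> K * \<epsilon>"
      by (auto simp: eventually_at_right_field intro: exI[of _ 1])
    moreover have "((\<lambda>\<epsilon>. K * \<epsilon>) \<longlongrightarrow> K * 0) (at_right 0)"
      by (intro tendsto_intros)
    ultimately have "L2_norm M D \<le> K * 0"
      by (intro tendsto_lowerbound) auto
    then have "L2_norm M D = 0" using L2_norm_nonneg[of M D] by simp
    then have "AE z in M. D z = 0" using DL by (intro L2_norm_eq_0_AE)
    then show "AE z in M. T (\<lambda>j z. a * \<omega> j z + b * \<eta> j z) z = a * T \<omega> z + b * T \<eta> z"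
      by (simp add: D_def \<theta>_def)
  qed
  then show ?thesis
    unfolding bounded_on_A2_01_def using TL T_bound agree by blast
qed

section \<open>The boundedness criterion\<close>

text \<open>
  The trace of \<open>S\<^sup>*S\<close> on a block: one radial eigenvalue and \<open>n - 1\<close> tangential ones.
\<close>

definition trace_value :: "nat \<Rightarrow> real" where
  "trace_value d = radial_value d + (real CARD('n) - 1) * weight_ratio (Suc d)"

lemma trace_value_eq:
  "(2 * real CARD('n) + real (Suc d) - 1) * mom (Suc d + 1) / ((real CARD('n) + real (Suc d)) * mom (Suc d))
     - mom (Suc d) / mom (Suc d - 1) = trace_value d"
proof -
  have pos: "0 < real CARD('n) + real (Suc d)" by (simp add: add_pos_nonneg)
  have "mom (Suc d + 1) / mom (Suc d) = (real CARD('n) + real (Suc d)) * weight_ratio (Suc d)"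
    using mom_ratio_weight_ratio[of "Suc d"] by simp
  then have "(2 * real CARD('n) + real (Suc d) - 1) * mom (Suc d + 1) / ((real CARD('n) + real (Suc d)) * mom (Suc d))
      = (2 * real CARD('n) + real (Suc d) - 1) * weight_ratio (Suc d)"
    using pos by (simp only: times_divide_times_eq[symmetric]) simp
  moreover have "mom (Suc d) / mom (Suc d - 1) = (real CARD('n) + real d) * weight_ratio d"
    using mom_ratio_weight_ratio[of d] by simp
  ultimately show ?thesis
    by (simp only: trace_value_def radial_value_def) (simp add: algebra_simps)
qed

text \<open>
  Eigenvectors serve as test forms: the radial form \<open>\<Sum>\<^sub>j z\<^sup>\<delta>\<^sup>+\<^sup>e\<^sup>j dz\<^sup>*\<^sub>j\<close> for \<open>X\<^sub>d\<close> and, if \<open>n \<ge> 2\<close>, the form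
  \<open>z\<^sub>k\<^sup>d dz\<^sup>*\<^sub>j\<close> with \<open>j \<noteq> k\<close> for \<open>Y\<^sub>d\<close>.
\<close>

lemma bounded_imp_trace_value_bounded:
  assumes S: "is_canonical_solution_operator M S" and b: "bounded_on_A2_01 M S"
  shows "\<exists>K. \<forall>d. trace_value d \<le> K"
proof -
  obtain T C where TL: "\<forall>\<omega>\<in>A2_01 M. T \<omega> \<in> L2 M"
    and T: "\<forall>\<omega>\<in>A2_01 M. L2_norm M (T \<omega>) \<le> C * form_norm M \<omega>"
    and TS: "\<forall>\<omega>\<in>polynomial_forms. AE z in M. T \<omega> z = S \<omega> z"
    using b unfolding bounded_on_A2_01_def by blast
  have test: "(L2_norm M (\<lambda>z. \<Sum>p\<in>F. u p * sol (fst p) (snd p) z))\<^sup>2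
      \<le> C\<^sup>2 * (\<Sum>p\<in>F. (cmod (u p))\<^sup>2 * monomial_norm2 (fst p))" if F: "finite F" for F u
  proof -
    let ?\<omega> = "form_of u F"
    have \<omega>: "?\<omega> \<in> polynomial_forms" using F by (rule form_of_polynomial)
    have "AE z in M. T ?\<omega> z = S ?\<omega> z" using TS \<omega> by blast
    then have "AE z in M. (\<Sum>p\<in>F. u p * sol (fst p) (snd p) z) = T ?\<omega> z"
      using canonical_form_of[OF S F, of u] by eventually_elim simp
    then have "L2_norm M (\<lambda>z. \<Sum>p\<in>F. u p * sol (fst p) (snd p) z) = L2_norm M (T ?\<omega>)"
      using TL polynomial_forms_A2_01[OF \<omega>]
      by (intro L2_norm_cong_AE L2_measurable L2_sum L2_scale sol_L2) auto
    then have "(L2_norm M (\<lambda>z. \<Sum>p\<in>F. u p * sol (fst p) (snd p) z))\<^sup>2 \<le> (C * form_norm M ?\<omega>)\<^sup>2"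
      using T polynomial_forms_A2_01[OF \<omega>] by (auto intro!: power_mono L2_norm_nonneg)
    then show ?thesis by (simp add: power_mult_distrib form_norm_form_of[OF F])
  qed
  have radial: "radial_value d \<le> C\<^sup>2" for d
  proof -
    fix j0 :: 'n
    define \<delta> where "\<delta> = (\<lambda>i. if i = j0 then d else 0)"
    have d: "total_degree \<delta> = d" by (simp add: \<delta>_def total_degree_def)
    let ?F = "range (\<lambda>j. (raise j \<delta>, j))"
    have inj: "inj (\<lambda>j. (raise j \<delta>, j))" by (auto simp: inj_on_def)
    have "radial_value d * (\<Sum>j\<in>UNIV. monomial_norm2 (raise j \<delta>)) \<le> C\<^sup>2 * (\<Sum>j\<in>UNIV. monomial_norm2 (raise j \<delta>))"
      using test[of ?F "\<lambda>_. 1"] radial_block_norm[of \<delta>] unfolding d sum.reindex[OF inj]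
      by (simp add: o_def)
    moreover have "0 < (\<Sum>j\<in>UNIV. monomial_norm2 (raise j \<delta>))"
      by (intro sum_pos monomial_norm2_pos) auto
    ultimately show ?thesis by simp
  qed
  have tangential: "(real CARD('n) - 1) * weight_ratio d \<le> (real CARD('n) - 1) * C\<^sup>2" for d
  proof (cases "CARD('n) = 1")
    case False
    fix k :: 'n
    have "2 \<le> CARD('n)" using False zero_less_card_finite[where 'a='n] by linarith
    have "(UNIV :: 'n set) \<noteq> {k}" using False by (metis is_singletonI is_singleton_altdef)
    then obtain j where j: "j \<noteq> k" by auto
    define \<alpha> where "\<alpha> = (\<lambda>i. if i = k then d else 0)"
    have d: "total_degree \<alpha> = d" by (simp add: \<alpha>_def total_degree_def)
    have 0: "\<alpha> j = 0" using j by (simp add: \<alpha>_def)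
    have "(L2_norm M (sol \<alpha> j))\<^sup>2 \<le> C\<^sup>2 * monomial_norm2 \<alpha>"
      using test[of "{(\<alpha>, j)}" "\<lambda>_. 1"] by simp
    then have "weight_ratio d * (mfact \<alpha> * degree_weight d) \<le> C\<^sup>2 * (mfact \<alpha> * degree_weight d)"
      unfolding sol_norm_vanishing_exponent[where \<alpha> = \<alpha> and j = j, OF 0] monomial_norm2_eq d degree_weight_Suc by (simp add: mult_ac)
    then have "weight_ratio d \<le> C\<^sup>2"
      using mfact_pos[of \<alpha>] degree_weight_pos[of d] by simp
    then show ?thesis by (intro mult_left_mono) (simp_all add: Suc_le_eq)
  qed simp
  have "trace_value d \<le> C\<^sup>2 + (real CARD('n) - 1) * C\<^sup>2" for d
    unfolding trace_value_def using radial tangential by (rule add_mono)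
  then show ?thesis by blast
qed

lemma trace_value_bounded_imp_bounded:
  assumes S: "is_canonical_solution_operator M S" and K: "\<And>d. trace_value d \<le> K"
  shows "bounded_on_A2_01 M S"
proof (rule bounded_extension)
  define L where "L = max K (weight_ratio 0)"
  have L0: "0 \<le> L" using weight_ratio_pos[of 0] by (simp add: L_def le_max_iff_disj)
  show SL: "\<And>\<omega>. \<omega> \<in> polynomial_forms \<Longrightarrow> S \<omega> \<in> L2 M"
    and "linear_on_forms M polynomial_forms S"
    using S by (auto simp: is_canonical_solution_operator_def)
  show "0 \<le> sqrt L" using L0 by simp
  fix \<omega> :: "'n form01" assume \<omega>: "\<omega> \<in> polynomial_forms"
  define F u where "F = support \<omega> \<times> (UNIV :: 'n set)" and "u = (\<lambda>p. coef (\<omega> (snd p)) (fst p))"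
  have F: "finite F" using support_finite[OF \<omega>] by (simp add: F_def)
  have eq: "form_of u F = \<omega>"
    unfolding u_def F_def by (rule polynomial_form_expansion[OF \<omega>, symmetric])
  have "AE z in M. S \<omega> z = (\<Sum>p\<in>F. u p * sol (fst p) (snd p) z)"
    using canonical_form_of[OF S F, of u] by (simp add: eq)
  then have "L2_norm M (S \<omega>) = L2_norm M (\<lambda>z. \<Sum>p\<in>F. u p * sol (fst p) (snd p) z)"
    by (intro L2_norm_cong_AE L2_measurable SL \<omega> L2_sum L2_scale sol_L2)
  moreover have "(L2_norm M (\<lambda>z. \<Sum>p\<in>F. u p * sol (fst p) (snd p) z))\<^sup>2
      \<le> L * (\<Sum>p\<in>F. (cmod (u p))\<^sup>2 * monomial_norm2 (fst p))"
    using K by (intro sol_combination_bound F) (auto simp: L_def trace_value_def le_max_iff_disj)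
  moreover have "(\<Sum>p\<in>F. (cmod (u p))\<^sup>2 * monomial_norm2 (fst p)) = (form_norm M \<omega>)\<^sup>2"
    using form_norm_form_of[OF F, of u] by (simp add: eq)
  ultimately have "(L2_norm M (S \<omega>))\<^sup>2 \<le> (sqrt L * form_norm M \<omega>)\<^sup>2"
    using L0 by (simp add: power_mult_distrib)
  then show "L2_norm M (S \<omega>) \<le> sqrt L * form_norm M \<omega>"
    by (rule power2_le_imp_le) (simp add: form_norm_nonneg L0)
qed

end

theorem corollary6:
  fixes M :: "(complex ^ 'n) measure" and m :: "nat \<Rightarrow> real"
  assumes borel: "sets M = sets borel"
    and invariant: "rotation_invariant M"
    and moments: "\<And>d. 0 < moment M d" "\<And>d. moment M d < \<infinity>"
    and m: "\<And>d. m d = enn2real (moment M d)"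
  shows "bounded_on_A2_01 M (canonical_solution_operator M) \<longleftrightarrow>
    (SUP d\<in>{1..}. ereal ((2 * real CARD('n) + real d - 1) * m (d + 1) / ((real CARD('n) + real d) * m d)
                        - m d / m (d - 1))) < \<infinity>"
proof -
  interpret rotation_invariant_measure M
    using borel invariant moments by unfold_locales
  have "m = mom" using m by (simp add: fun_eq_iff mom_def)
  have "(SUP d\<in>{1..}. ereal ((2 * real CARD('n) + real d - 1) * m (d + 1) / ((real CARD('n) + real d) * m d)
      - m d / m (d - 1))) = (SUP d. ereal (trace_value d))"
  proof -
    have "{1..} = range Suc"
      by (auto simp: image_iff) (metis Suc_le_D One_nat_def)
    then show ?thesis
      unfolding \<open>m = mom\<close> by (simp only: image_image trace_value_eq)
  qed
  moreover have "(SUP d. ereal (trace_value d)) < \<infinity> \<longleftrightarrow> (\<exists>K. \<forall>d. trace_value d \<le> K)"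
  proof
    assume "(SUP d. ereal (trace_value d)) < \<infinity>"
    then obtain k :: nat where k: "(SUP d. ereal (trace_value d)) < ereal (real k)"
      using less_PInf_Ex_of_nat by auto
    have "trace_value d \<le> real k" for d
    proof -
      have "ereal (trace_value d) \<le> (SUP d. ereal (trace_value d))" by (rule SUP_upper) simp
      then have "ereal (trace_value d) \<le> ereal (real k)" using k by (rule order_trans[OF _ less_imp_le])
      then show ?thesis by simp
    qed
    then show "\<exists>K. \<forall>d. trace_value d \<le> K" by blast
  next
    assume "\<exists>K. \<forall>d. trace_value d \<le> K"
    then obtain K where "\<forall>d. trace_value d \<le> K" by blast
    then have "(SUP d. ereal (trace_value d)) \<le> ereal K" by (intro SUP_least) simp
    then show "(SUP d. ereal (trace_value d)) < \<infinity>" by (rule le_less_trans) simp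
  qed
  moreover have "bounded_on_A2_01 M (canonical_solution_operator M) \<longleftrightarrow> (\<exists>K. \<forall>d. trace_value d \<le> K)"
  proof
    assume "bounded_on_A2_01 M (canonical_solution_operator M)"
    then show "\<exists>K. \<forall>d. trace_value d \<le> K"
      by (rule bounded_imp_trace_value_bounded[OF canonical_solution_operator_canonical])
  next
    assume "\<exists>K. \<forall>d. trace_value d \<le> K"
    then obtain K where "\<And>d. trace_value d \<le> K" by auto
    then show "bounded_on_A2_01 M (canonical_solution_operator M)"
      by (rule trace_value_bounded_imp_bounded[OF canonical_solution_operator_canonical])
  qed
  ultimately show ?thesis by (simp only:)
qed

end
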